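(* Let $d\ge 1$, let $\mathcal{D}=\mathcal{D}_1\times\cdots\times\mathcal{D}_d$ be a known product distribution on $\mathbb{R}^d$, and let $\varepsilon\in(0,1)$. There exists a (randomized) meta-algorithm $\mathcal{M}$ which, given oracle access to an arbitrary function $f:\mathbb{R}^d\to[0,1]$, produces a function $\mathcal{M}_f:\mathbb{R}^d\to[0,1]$ such that: 1. $\mathcal{M}_f$ is monotone: $x\le y$ implies $\mathcal{M}_f(x)\le \mathcal{M}_f(y)$; 2. $\mathcal{M}_f$ is feasible: $\mathcal{M}_f(x)\le \max_{y\le x} f(y)$ for every $x\in\mathbb{R}^d$; 3. the query complexity of $\mathcal{M}$ is $O\left(\log\frac{d}{\varepsilon}\right)^d$; 4. $\mathbb{E}[\mathcal{M}_f(x)]\ge \mathbb{E}_{x\sim\mathcal{D}}[f(x)]-\varepsilon$, where the first expectation is over $x\sim\mathcal{D}$ and the internal randomness of the meta-algorithm.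
   Context: For $x,y\in\mathbb{R}^d$, $x\le y$ means $x_i\le y_i$ for all $i$. Functions are assumed measurable so that expectations make sense, and $\max_{y\le x} f(y)$ is read as a supremum when it is not attained. Meta-algorithm: a procedure that knows $\mathcal{D}$ and $\varepsilon$, draws a random seed (internal randomness) independent of the inputs and shared by all inputs, and on an input point $x\in\mathbb{R}^d$ adaptively queries the oracle for $f$ at points of its choice and outputs a number $\mathcal{M}_f(x)\in[0,1]$. For a fixed seed, $\mathcal{M}_f$ is thus a deterministic function of $x$ (the answers are local: no memory of previous inputs is needed). Monotonicity and feasibility are required for every realization of the seed. Query complexity: the maximum number of oracle calls to $f$ made in order to answer a single input $x$. $O(\log\frac d\varepsilon)^d$ means at most $(C\log\frac d\varepsilon)^d$ for an absolute constant $C$ (for $d/\varepsilon$ at least $2$). *)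

theory Defs
  imports "HOL-Probability.Probability"
begin

text \<open>
  The dimension is a number rather than a type, because the constant in the query bound must not
  depend on it. A \<open>d\<close>-dimensional real vector is an extensional function on \<open>{..<d}\<close>; hence the
  pointwise order on \<open>nat \<Rightarrow> real\<close> restricts to the coordinatewise order on \<open>points d\<close>,
  and \<open>points d\<close> is the space of \<open>PiM {..<d} D\<close> for real distributions \<open>D i\<close>.
\<close>

definition points :: "nat \<Rightarrow> (nat \<Rightarrow> real) set" where
  "points d = {..<d} \<rightarrow>\<^sub>E UNIV"

definition oracles :: "nat \<Rightarrow> ((nat \<Rightarrow> real) \<Rightarrow> real) set" where
  "oracles d = points d \<rightarrow> {0..1}"

text \<open>
  A deterministic adaptive computation with oracle access: either it stops with an
  output, or it queries a point and continues depending on the oracle's answer.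
\<close>

datatype 'p query_tree = Output real | Query 'p "real \<Rightarrow> 'p query_tree"

primrec answer :: "'p query_tree \<Rightarrow> ('p \<Rightarrow> real) \<Rightarrow> real" where
  "answer (Output v) f = v"
| "answer (Query p k) f = answer (k (f p)) f"

primrec queries :: "'p query_tree \<Rightarrow> ('p \<Rightarrow> real) \<Rightarrow> 'p list" where
  "queries (Output v) f = []"
| "queries (Query p k) f = p # queries (k (f p)) f"

text \<open>
  A randomized algorithm consists of a probability space of seeds and, for every seed and
  every input point, a query tree. All inputs share the seed, and repeated queries count repeatedly.
  Seeds are sequences of reals, with an arbitrary probability measure on them.
\<close>

record algorithm =
  seeds :: "(nat \<Rightarrow> real) measure"
  strategy :: "(nat \<Rightarrow> real) \<Rightarrow> (nat \<Rightarrow> real) \<Rightarrow> (nat \<Rightarrow> real) query_tree"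

definition result ::
  "algorithm \<Rightarrow> ((nat \<Rightarrow> real) \<Rightarrow> real) \<Rightarrow> (nat \<Rightarrow> real) \<Rightarrow> (nat \<Rightarrow> real) \<Rightarrow> real" where
  "result M f r x = answer (strategy M r x) f"

definition meta_algorithm :: "nat \<Rightarrow> algorithm \<Rightarrow> bool" where
  "meta_algorithm d M \<longleftrightarrow>
     prob_space (seeds M) \<and>
     (\<forall>f\<in>oracles d. \<forall>r\<in>space (seeds M). \<forall>x\<in>points d.
        set (queries (strategy M r x) f) \<subseteq> points d \<and> result M f r x \<in> {0..1})"

definition query_complexity :: "nat \<Rightarrow> algorithm \<Rightarrow> enat" where
  "query_complexity d M =
     (SUP (f, r, x) \<in> oracles d \<times> space (seeds M) \<times> points d.
        enat (length (queries (strategy M r x) f)))"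

end

theory Submission
  imports Defs
begin

text \<open>
  In dimension one with uniform inputs, search for \<open>x\<close> as in a binary search tree with random
  pivots, keeping an interval \<open>(a, b)\<close> around \<open>x\<close> and bounds \<open>lo \<le> hi\<close> for the output. At a
  uniform pivot \<open>y \<in> (a, b)\<close>, the value \<open>f y\<close> clipped to \<open>[lo, hi]\<close> becomes the new \<open>lo\<close> if
  \<open>y \<le> x\<close> and the new \<open>hi\<close> otherwise; the output is the final \<open>lo\<close>. It is monotone in \<open>x\<close>
  and bounded by values of \<open>f\<close> left of \<open>x\<close>. One step preserves the integral of the
  clipped \<open>f\<close> exactly: \<open>x\<close> and \<open>y\<close> are exchangeable, and the smaller one gets the minimum and
  the larger one the maximum of the two values. The error of returning \<open>lo\<close> is at most the area
  \<open>(b - a) * (hi - lo)\<close>, whose expected total over the pieces shrinks by a constant factor in each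
  step, so logarithmically many steps suffice.

  A general distribution is reduced to the uniform one by its quantile function and a randomized
  distribution function. For fixed seeds the one-dimensional procedure is a monotone operator on
  functions, so applying it along one coordinate keeps monotonicity along the others. Hence the
  composition over all coordinates is monotone; query counts multiply and errors add.
\<close>

section \<open>Random binary search\<close>

definition clip :: "real \<Rightarrow> real \<Rightarrow> real \<Rightarrow> real" where
  "clip lo hi v = max lo (min hi v)"

lemma clip_bounds: "lo \<le> hi \<Longrightarrow> lo \<le> clip lo hi v" "lo \<le> hi \<Longrightarrow> clip lo hi v \<le> hi"
  by (auto simp: clip_def)

lemma clip_mono: "lo \<le> lo' \<Longrightarrow> hi \<le> hi' \<Longrightarrow> v \<le> v' \<Longrightarrow> clip lo hi v \<le> clip lo' hi' v'"
  by (auto simp: clip_def)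

text \<open>Once a pivot has clipped value \<open>clip lo hi w\<close>, the clipped values to its
  left and right become the minimum and the maximum with it. This is the pointwise form of the
  exchange between pivot and point.\<close>

lemma clip_clip:
  "lo \<le> hi \<Longrightarrow> clip lo (clip lo hi w) v = min (clip lo hi v) (clip lo hi w)"
  "lo \<le> hi \<Longrightarrow> clip (clip lo hi w) hi v = max (clip lo hi v) (clip lo hi w)"
  by (auto simp: clip_def min_def max_def)

lemma measurable_clip [measurable (raw)]:
  assumes [measurable]: "f \<in> borel_measurable M" "g \<in> borel_measurable M" "h \<in> borel_measurable M"
  shows "(\<lambda>x. clip (f x) (g x) (h x)) \<in> borel_measurable M"
  unfolding clip_def by measurable

text \<open>\<open>T\<close> counts the remaining pivots and \<open>i\<close> is the index of the
  next seed. Seeds are indexed by depth, so both branches below a pivot share the later seeds; their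
  dependence is harmless because only sums of expectations are formed.\<close>

primrec search ::
  "nat \<Rightarrow> nat \<Rightarrow> (nat \<Rightarrow> real) \<Rightarrow> (real \<Rightarrow> real) \<Rightarrow> real \<Rightarrow> real \<Rightarrow> real \<Rightarrow> real \<Rightarrow> real \<Rightarrow> real" where
  "search 0 i r g a b lo hi x = lo"
| "search (Suc T) i r g a b lo hi x =
     (let y = a + r i * (b - a); v = clip lo hi (g y)
      in if y \<le> x then search T (Suc i) r g y b v hi x else search T (Suc i) r g a y lo v x)"

lemma search_bounds:
  assumes "lo \<le> hi"
  shows "lo \<le> search T i r g a b lo hi x \<and> search T i r g a b lo hi x \<le> hi"
  using assms
proof (induction T arbitrary: i a b lo hi)
  case (Suc T)
  define y where "y = a + r i * (b - a)"
  define v where "v = clip lo hi (g y)"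
  have v: "lo \<le> v" "v \<le> hi"
    using Suc.prems by (auto simp: v_def clip_bounds)
  show ?case
    using Suc.IH[OF v(1), of "Suc i" a y] Suc.IH[OF v(2), of "Suc i" y b] v
    by (auto simp: Let_def simp flip: y_def v_def)
qed simp

text \<open>As long as both searches branch alike, induction applies. Where a pivot separates
  \<open>x\<close> from \<open>x'\<close>, the left output is at most \<open>v\<close> and the right
  one at least \<open>v' \<ge> v\<close>. Monotonicity in \<open>g\<close> is what the composition
  over the coordinates uses.\<close>

lemma search_mono:
  assumes "lo \<le> hi" "lo' \<le> hi'" "lo \<le> lo'" "hi \<le> hi'" "\<And>z. g z \<le> g' z" "x \<le> x'"
  shows "search T i r g a b lo hi x \<le> search T i r g' a b lo' hi' x'"
  using assms(1-4)
proof (induction T arbitrary: i a b lo hi lo' hi')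
  case (Suc T)
  define y where "y = a + r i * (b - a)"
  define v where "v = clip lo hi (g y)"
  define v' where "v' = clip lo' hi' (g' y)"
  have v: "lo \<le> v" "v \<le> hi" and v': "lo' \<le> v'" "v' \<le> hi'"
    using Suc.prems by (auto simp: v_def v'_def clip_bounds)
  have vv': "v \<le> v'"
    using Suc.prems assms(5) by (auto simp: v_def v'_def intro!: clip_mono)
  have 1: "search T (Suc i) r g y b v hi x \<le> search T (Suc i) r g' y b v' hi' x'"
    using v v' vv' Suc.prems by (intro Suc.IH) auto
  have 2: "search T (Suc i) r g a y lo v x \<le> search T (Suc i) r g' a y lo' v' x'"
    using v v' vv' Suc.prems by (intro Suc.IH) auto
  have 3: "search T (Suc i) r g a y lo v x \<le> search T (Suc i) r g' y b v' hi' x'"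
    using search_bounds[OF v(1), of T "Suc i" r g a y x]
      search_bounds[OF v'(2), of T "Suc i" r g' y b x'] vv' by linarith
  show ?case
    using 1 2 3 assms(6) by (auto simp: Let_def simp flip: y_def v_def v'_def)
qed simp

lemma pivot_between:
  fixes a b u :: real
  assumes "a < b" "0 < u" "u < 1"
  shows "a < a + u * (b - a)" "a + u * (b - a) < b"
proof -
  show "a < a + u * (b - a)" using assms by simp
  have "u * (b - a) < 1 * (b - a)" using assms by (intro mult_strict_right_mono) auto
  then show "a + u * (b - a) < b" by simp
qed

text \<open>The lower bound is raised only at pivots \<open>y \<le> x\<close>, and never beyond the
  larger of its old value and \<open>g y\<close>. Seeds strictly between 0 and 1 keep all pivots
  inside the open unit interval.\<close>

lemma search_le:
  assumes "lo \<le> B" "0 \<le> a" "a < b" "b \<le> 1"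
    and "\<And>j. i \<le> j \<Longrightarrow> j < i + T \<Longrightarrow> 0 < r j \<and> r j < 1"
    and "\<And>z. 0 < z \<Longrightarrow> z < 1 \<Longrightarrow> z \<le> x \<Longrightarrow> g z \<le> B"
  shows "search T i r g a b lo hi x \<le> B"
  using assms(1-5)
proof (induction T arbitrary: i a b lo hi)
  case (Suc T)
  define y where "y = a + r i * (b - a)"
  define v where "v = clip lo hi (g y)"
  have y: "a < y" "y < b"
    using pivot_between[of a b "r i"] Suc.prems by (auto simp: y_def)
  have "search T (Suc i) r g y b v hi x \<le> B" if "y \<le> x"
    using that Suc.prems assms(6)[of y] y by (intro Suc.IH) (auto simp: v_def clip_def)
  moreover have "search T (Suc i) r g a y lo v x \<le> B"
    using Suc.prems y by (intro Suc.IH) auto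
  ultimately show ?case
    by (auto simp: Let_def simp flip: y_def v_def)
qed simp

text \<open>Stands in for the independence of seed blocks: the search reads only the
  \<open>T\<close> seeds from \<open>i\<close> on.\<close>

lemma search_fun_upd:
  "j < i \<or> i + T \<le> j \<Longrightarrow> search T i (r(j := u)) g a b lo hi x = search T i r g a b lo hi x"
  by (induction T arbitrary: i a b lo hi) (auto simp: Let_def)

text \<open>The interval and the bounds vary with \<open>w\<close>, since the recursion replaces
  them by the random pivot and its clipped value.\<close>

lemma measurable_search:
  assumes g[measurable]: "(\<lambda>(w, z). g w z) \<in> borel_measurable (M \<Otimes>\<^sub>M borel)"
    and x[measurable]: "x \<in> borel_measurable M"
    and "a \<in> borel_measurable M" "b \<in> borel_measurable M"
    and "lo \<in> borel_measurable M" "hi \<in> borel_measurable M"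
    and "\<And>j. i \<le> j \<Longrightarrow> j < i + T \<Longrightarrow> (\<lambda>w. r w j) \<in> borel_measurable M"
  shows "(\<lambda>w. search T i (r w) (g w) (a w) (b w) (lo w) (hi w) (x w)) \<in> borel_measurable M"
  using assms(3-7)
proof (induction T arbitrary: i a b lo hi)
  case (Suc T)
  note Suc.prems(1-4)[measurable]
  have [measurable]: "(\<lambda>w. r w i) \<in> borel_measurable M"
    using Suc.prems(5)[of i] by simp
  define y where "y = (\<lambda>w. a w + r w i * (b w - a w))"
  have y[measurable]: "y \<in> borel_measurable M"
    unfolding y_def by measurable
  define v where "v = (\<lambda>w. clip (lo w) (hi w) (g w (y w)))"
  have v[measurable]: "v \<in> borel_measurable M"
    unfolding v_def by measurable
  have [measurable]:
    "(\<lambda>w. search T (Suc i) (r w) (g w) (y w) (b w) (v w) (hi w) (x w)) \<in> borel_measurable M"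
    "(\<lambda>w. search T (Suc i) (r w) (g w) (a w) (y w) (lo w) (v w) (x w)) \<in> borel_measurable M"
    using Suc.prems by (auto intro!: Suc.IH y v)
  have "(\<lambda>w. search (Suc T) i (r w) (g w) (a w) (b w) (lo w) (hi w) (x w)) =
    (\<lambda>w. if y w \<le> x w then search T (Suc i) (r w) (g w) (y w) (b w) (v w) (hi w) (x w)
      else search T (Suc i) (r w) (g w) (a w) (y w) (lo w) (v w) (x w))"
    by (auto simp: Let_def y_def v_def)
  also have "\<dots> \<in> borel_measurable M"
    by measurable
  finally show ?case .
qed simp

text \<open>Restricting the space itself to the open interval puts every seed strictly between 0 and
  1. Monotonicity and feasibility are demanded for every seed, not just for almost every
  one.\<close>

definition unit_uniform :: "real measure" where
  "unit_uniform = restrict_space lborel {0<..<1}"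

lemma space_unit_uniform: "space unit_uniform = {0<..<1}"
  by (simp add: unit_uniform_def space_restrict_space)

lemma prob_space_unit_uniform: "prob_space unit_uniform"
  by (auto simp: unit_uniform_def emeasure_restrict_space space_restrict_space intro!: prob_spaceI)

lemma measurable_unit_uniform: "(\<lambda>u. u) \<in> unit_uniform \<rightarrow>\<^sub>M borel"
  unfolding unit_uniform_def by (rule measurable_restrict_space1) simp

lemma nn_integral_unit_uniform:
  "(\<integral>\<^sup>+u. f u \<partial>unit_uniform) = (\<integral>\<^sup>+u\<in>{0<..<1}. f u \<partial>lborel)"
  unfolding unit_uniform_def by (rule nn_integral_restrict_space) simp

lemma measurable_unit_uniform_component:
  "f \<in> M \<rightarrow>\<^sub>M PiM I (\<lambda>_. unit_uniform) \<Longrightarrow> i \<in> I \<Longrightarrow> (\<lambda>w. f w i) \<in> borel_measurable M"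
  by (rule measurable_compose[OF _ measurable_unit_uniform])
     (rule measurable_compose[OF _ measurable_component_singleton])

section \<open>Integrals over a uniform pivot\<close>

lemma nn_integral_pivot:
  assumes [measurable]: "f \<in> borel_measurable borel" and "a < b"
  shows "ennreal (b - a) * (\<integral>\<^sup>+u. f (a + u * (b - a)) \<partial>unit_uniform) = (\<integral>\<^sup>+y\<in>{a<..<b}. f y \<partial>lborel)"
proof -
  have "(\<integral>\<^sup>+y\<in>{a<..<b}. f y \<partial>lborel) =
    ennreal \<bar>b - a\<bar> * (\<integral>\<^sup>+u. f (a + (b - a) * u) * indicator {a<..<b} (a + (b - a) * u) \<partial>lborel)"
    using assms by (subst nn_integral_real_affine[of _ "b - a" a]) auto
  also have "(\<integral>\<^sup>+u. f (a + (b - a) * u) * indicator {a<..<b} (a + (b - a) * u) \<partial>lborel) =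
     (\<integral>\<^sup>+u\<in>{0<..<1}. f (a + u * (b - a)) \<partial>lborel)"
  proof (intro nn_integral_cong)
    fix u :: real
    have "a + (b - a) * u < b \<longleftrightarrow> u < 1"
      using assms(2) mult_less_cancel_left_pos[of "b - a" u 1] by (simp add: less_diff_eq add.commute)
    then have "a + (b - a) * u \<in> {a<..<b} \<longleftrightarrow> u \<in> {0<..<1}"
      using assms(2) by (simp add: zero_less_mult_iff)
    then show "f (a + (b - a) * u) * indicator {a<..<b} (a + (b - a) * u) =
      f (a + u * (b - a)) * indicator {0<..<1} u"
      by (auto simp: indicator_def mult.commute)
  qed
  finally show ?thesis
    using assms(2) by (simp add: nn_integral_unit_uniform)
qed


lemma nn_integral_lborel_swap:
  fixes K :: "real \<Rightarrow> real \<Rightarrow> ennreal"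
  assumes [measurable]: "(\<lambda>(y, z). K y z) \<in> borel_measurable (borel \<Otimes>\<^sub>M borel)"
  shows "(\<integral>\<^sup>+y. \<integral>\<^sup>+z. K y z \<partial>lborel \<partial>lborel) = (\<integral>\<^sup>+y. \<integral>\<^sup>+z. K z y \<partial>lborel \<partial>lborel)"
  by (rule lborel_pair.Fubini'[symmetric]) measurable

text \<open>Both terms integrate over a triangle of pairs. Swapping the variables in the second puts
  both on \<open>z < y\<close>, where minimum plus maximum is \<open>h z + h y\<close>. Swapping
  back the \<open>h z\<close> part leaves \<open>h y\<close> integrated over both triangles, that
  is, over the square up to its null diagonal.\<close>

lemma nn_integral_sort_pairs:
  fixes h :: "real \<Rightarrow> ennreal"
  assumes h[measurable]: "h \<in> borel_measurable borel" and "a < b"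
  shows "(\<integral>\<^sup>+y\<in>{a<..<b}. ((\<integral>\<^sup>+z\<in>{a<..<y}. min (h z) (h y) \<partial>lborel)
      + (\<integral>\<^sup>+z\<in>{y<..<b}. max (h z) (h y) \<partial>lborel)) \<partial>lborel)
    = ennreal (b - a) * (\<integral>\<^sup>+y\<in>{a<..<b}. h y \<partial>lborel)" (is "?L = ?R")
proof -
  have "?L = (\<integral>\<^sup>+y. ((\<integral>\<^sup>+z. (if a < z \<and> z < y \<and> y < b then min (h z) (h y) else 0) \<partial>lborel)
      + (\<integral>\<^sup>+z. (if a < y \<and> y < z \<and> z < b then max (h z) (h y) else 0) \<partial>lborel)) \<partial>lborel)"
  proof (intro nn_integral_cong)
    fix y :: real
    have 1: "(\<integral>\<^sup>+z. (if a < z \<and> z < y \<and> y < b then min (h z) (h y) else 0) \<partial>lborel) =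
      (\<integral>\<^sup>+z\<in>{a<..<y}. min (h z) (h y) \<partial>lborel) * indicator {a<..<b} y"
      by (subst nn_integral_multc[symmetric]) (simp, intro nn_integral_cong, simp add: indicator_def)
    have 2: "(\<integral>\<^sup>+z. (if a < y \<and> y < z \<and> z < b then max (h z) (h y) else 0) \<partial>lborel) =
      (\<integral>\<^sup>+z\<in>{y<..<b}. max (h z) (h y) \<partial>lborel) * indicator {a<..<b} y"
      by (subst nn_integral_multc[symmetric]) (simp, intro nn_integral_cong, simp add: indicator_def)
    show "((\<integral>\<^sup>+z\<in>{a<..<y}. min (h z) (h y) \<partial>lborel)
        + (\<integral>\<^sup>+z\<in>{y<..<b}. max (h z) (h y) \<partial>lborel)) * indicator {a<..<b} y =
      (\<integral>\<^sup>+z. (if a < z \<and> z < y \<and> y < b then min (h z) (h y) else 0) \<partial>lborel)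
      + (\<integral>\<^sup>+z. (if a < y \<and> y < z \<and> z < b then max (h z) (h y) else 0) \<partial>lborel)"
      unfolding 1 2 by (simp add: distrib_right)
  qed
  also have "\<dots> = (\<integral>\<^sup>+y. \<integral>\<^sup>+z. (if a < z \<and> z < y \<and> y < b then min (h z) (h y) else 0) \<partial>lborel \<partial>lborel)
      + (\<integral>\<^sup>+y. \<integral>\<^sup>+z. (if a < y \<and> y < z \<and> z < b then max (h z) (h y) else 0) \<partial>lborel \<partial>lborel)"
    by (rule nn_integral_add) measurable
  also have "(\<integral>\<^sup>+y. \<integral>\<^sup>+z. (if a < y \<and> y < z \<and> z < b then max (h z) (h y) else 0) \<partial>lborel \<partial>lborel) =
      (\<integral>\<^sup>+y. \<integral>\<^sup>+z. (if a < z \<and> z < y \<and> y < b then max (h y) (h z) else 0) \<partial>lborel \<partial>lborel)"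
    by (rule nn_integral_lborel_swap) measurable
  also have "(\<integral>\<^sup>+y. \<integral>\<^sup>+z. (if a < z \<and> z < y \<and> y < b then min (h z) (h y) else 0) \<partial>lborel \<partial>lborel)
      + (\<integral>\<^sup>+y. \<integral>\<^sup>+z. (if a < z \<and> z < y \<and> y < b then max (h y) (h z) else 0) \<partial>lborel \<partial>lborel)
    = (\<integral>\<^sup>+y. \<integral>\<^sup>+z. (if a < z \<and> z < y \<and> y < b then h z + h y else 0) \<partial>lborel \<partial>lborel)"
    by (simp flip: nn_integral_add, intro nn_integral_cong)
       (auto simp: min_def max_def add.commute)
  also have "\<dots> = (\<integral>\<^sup>+y. \<integral>\<^sup>+z. (if a < z \<and> z < y \<and> y < b then h z else 0) \<partial>lborel \<partial>lborel)
      + (\<integral>\<^sup>+y. \<integral>\<^sup>+z. (if a < z \<and> z < y \<and> y < b then h y else 0) \<partial>lborel \<partial>lborel)"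
    by (simp flip: nn_integral_add, intro nn_integral_cong) auto
  also have "(\<integral>\<^sup>+y. \<integral>\<^sup>+z. (if a < z \<and> z < y \<and> y < b then h z else 0) \<partial>lborel \<partial>lborel) =
      (\<integral>\<^sup>+y. \<integral>\<^sup>+z. (if a < y \<and> y < z \<and> z < b then h y else 0) \<partial>lborel \<partial>lborel)"
    by (rule nn_integral_lborel_swap) measurable
  also have "\<dots> + (\<integral>\<^sup>+y. \<integral>\<^sup>+z. (if a < z \<and> z < y \<and> y < b then h y else 0) \<partial>lborel \<partial>lborel) =
      (\<integral>\<^sup>+y. \<integral>\<^sup>+z. (if a < y \<and> y < z \<and> z < b then h y else 0)
        + (if a < z \<and> z < y \<and> y < b then h y else 0) \<partial>lborel \<partial>lborel)"
    by (simp flip: nn_integral_add)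
  also have "\<dots> = (\<integral>\<^sup>+y. \<integral>\<^sup>+z. (h y * indicator {a<..<b} y) * indicator {a<..<b} z \<partial>lborel \<partial>lborel)"
  proof (rule nn_integral_cong, rule nn_integral_cong_AE)
    fix y :: real
    \<comment> \<open>The point \<open>z = y\<close> belongs to neither triangle.\<close>
    show "AE z in lborel. (if a < y \<and> y < z \<and> z < b then h y else 0)
        + (if a < z \<and> z < y \<and> y < b then h y else 0) =
      (h y * indicator {a<..<b} y) * indicator {a<..<b} z"
      using AE_lborel_singleton[of y] by eventually_elim (auto simp: indicator_def)
  qed
  also have "\<dots> = ?R"
    using assms(2) by (simp add: nn_integral_cmult nn_integral_multc mult.commute)
  finally show ?thesis .
qed

text \<open>By \<open>clip_clip\<close>, the integrands on the two sides of the pivot are the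
  minimum and the maximum of the clipped values at \<open>z\<close> and \<open>y\<close>, so
  \<open>nn_integral_sort_pairs\<close> averages them back to the original integral. The common
  factor \<open>b - a\<close> cancels.\<close>

lemma nn_integral_search_step:
  assumes g[measurable]: "g \<in> borel_measurable borel" and "a < b" "lo \<le> hi"
  shows "(\<integral>\<^sup>+u. (let y = a + u * (b - a); v = clip lo hi (g y) in
      (\<integral>\<^sup>+z\<in>{a<..<y}. ennreal (clip lo v (g z)) \<partial>lborel)
      + (\<integral>\<^sup>+z\<in>{y<..<b}. ennreal (clip v hi (g z)) \<partial>lborel)) \<partial>unit_uniform)
    = (\<integral>\<^sup>+z\<in>{a<..<b}. ennreal (clip lo hi (g z)) \<partial>lborel)" (is "?L = ?R")
proof -
  define h where "h z = ennreal (clip lo hi (g z))" for z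
  have [measurable]: "h \<in> borel_measurable borel"
    unfolding h_def by measurable
  define W where "W y = (\<integral>\<^sup>+z\<in>{a<..<y}. min (h z) (h y) \<partial>lborel)
      + (\<integral>\<^sup>+z\<in>{y<..<b}. max (h z) (h y) \<partial>lborel)" for y
  have W[measurable]: "W \<in> borel_measurable borel"
  proof -
    have "W = (\<lambda>y. (\<integral>\<^sup>+z. (if a < z \<and> z < y then min (h z) (h y) else 0) \<partial>lborel)
      + (\<integral>\<^sup>+z. (if y < z \<and> z < b then max (h z) (h y) else 0) \<partial>lborel))"
      unfolding W_def
      by (intro ext arg_cong2[where f="(+)"] nn_integral_cong) (auto simp: indicator_def)
    also have "\<dots> \<in> borel_measurable borel" by measurable
    finally show ?thesis .
  qed
  have *: "ennreal (min x y) = min (ennreal x) (ennreal y)" "ennreal (max x y) = max (ennreal x) (ennreal y)"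
    for x y
    using ennreal_leI[of x y] ennreal_leI[of y x] by (auto simp: min_def max_def intro: antisym)
  have "?L = (\<integral>\<^sup>+u. W (a + u * (b - a)) \<partial>unit_uniform)"
    using assms(3) by (simp add: Let_def W_def h_def clip_clip *)
  then have "ennreal (b - a) * ?L = (\<integral>\<^sup>+y\<in>{a<..<b}. W y \<partial>lborel)"
    using nn_integral_pivot[OF W assms(2)] by simp
  also have "\<dots> = ennreal (b - a) * ?R"
    unfolding W_def using nn_integral_sort_pairs[of h a b] assms(2) by (simp add: h_def)
  finally show ?thesis
    using assms(2) by (simp add: ennreal_mult_cancel_left)
qed

text \<open>The two boxes after a pivot meet at the corner \<open>(y, v)\<close> of the old box's
  interior grid. At relative pivot position \<open>u\<close> their total area is at most
  \<open>max u (1 - u)\<close> times the old one whatever \<open>v\<close> is, so the randomness of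
  the pivot alone yields a contraction.\<close>

lemma nn_integral_search_step_width:
  assumes "a < b" "lo \<le> hi"
  shows "(\<integral>\<^sup>+u. (let y = a + u * (b - a); v = clip lo hi (g y) in
      ennreal ((y - a) * (v - lo) + (b - y) * (hi - v))) \<partial>unit_uniform)
    \<le> ennreal (5 / 6 * ((b - a) * (hi - lo)))"
proof -
  define c where "c = (b - a) * (hi - lo)"
  have "0 \<le> c" using assms by (simp add: c_def)
  have le: "(y - a) * (v - lo) + (b - y) * (hi - v) \<le> c * (1 - u + u\<^sup>2)"
    if "y = a + u * (b - a)" "lo \<le> v" "v \<le> hi" "0 < u" "u < 1" for u v y
  proof -
    \<comment> \<open>\<open>1 - u + u\<^sup>2\<close> is a polynomial upper bound of \<open>max u (1 - u)\<close> with integral \<open>5 / 6\<close>.\<close>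
    have "u * (v - lo) + (1 - u) * (hi - v) \<le> (1 - u + u\<^sup>2) * (v - lo) + (1 - u + u\<^sup>2) * (hi - v)"
      using that sum_squares_ge_zero[of "1 - u" 0]
      by (intro add_mono mult_right_mono) (auto simp: power2_eq_square algebra_simps)
    then have "(b - a) * (u * (v - lo) + (1 - u) * (hi - v)) \<le> (b - a) * ((1 - u + u\<^sup>2) * (hi - lo))"
      using assms(1) by (intro mult_left_mono) (auto simp: algebra_simps)
    then show ?thesis
      unfolding that(1) c_def by (simp add: algebra_simps)
  qed
  have "(\<integral>\<^sup>+u. (let y = a + u * (b - a); v = clip lo hi (g y) in
      ennreal ((y - a) * (v - lo) + (b - y) * (hi - v))) \<partial>unit_uniform)
    \<le> (\<integral>\<^sup>+u. ennreal (c * (1 - u + u\<^sup>2)) \<partial>unit_uniform)"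
    using le assms clip_bounds[OF assms(2)]
    by (intro nn_integral_mono) (auto simp: Let_def space_unit_uniform intro!: ennreal_leI)
  also have "\<dots> \<le> (\<integral>\<^sup>+u. ennreal (c * (1 - u + u\<^sup>2)) * indicator {0..1} u \<partial>lborel)"
    unfolding nn_integral_unit_uniform by (intro nn_integral_mono) (auto simp: indicator_def)
  also have "\<dots> = ennreal ((\<lambda>u. c * (u - u\<^sup>2 / 2 + u ^ 3 / 3)) 1 - (\<lambda>u. c * (u - u\<^sup>2 / 2 + u ^ 3 / 3)) 0)"
  proof (rule nn_integral_FTC_Icc)
    fix u :: real assume u: "u \<in> {0..1}"
    show "((\<lambda>u. c * (u - u\<^sup>2 / 2 + u ^ 3 / 3)) has_real_derivative c * (1 - u + u\<^sup>2)) (at u)"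
      by (auto intro!: derivative_eq_intros simp: power2_eq_square)
    show "0 \<le> c * (1 - u + u\<^sup>2)"
      using u \<open>0 \<le> c\<close> by simp
  qed auto
  also have "\<dots> = ennreal (5 / 6 * c)"
    by (rule arg_cong[where f=ennreal]) (simp add: field_simps)
  finally show ?thesis by (simp add: c_def)
qed

text \<open>Redrawing one coordinate from its own factor preserves the product measure: once that
  factor is split off, the overwritten value is integrated against a probability measure. This
  serves for single seeds as well as for single input coordinates.\<close>

lemma (in product_sigma_finite) nn_integral_PiM_resample:
  assumes I: "finite I" "i \<in> I" and "prob_space (M i)"
    and f[measurable]: "f \<in> borel_measurable (PiM I M)"
  shows "(\<integral>\<^sup>+x. \<integral>\<^sup>+y. f (x(i := y)) \<partial>M i \<partial>PiM I M) = (\<integral>\<^sup>+x. f x \<partial>PiM I M)"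
proof -
  interpret i: prob_space "M i" by fact
  define J where "J = I - {i}"
  have J: "finite J" "i \<notin> J" "I = insert i J"
    using I by (auto simp: J_def)
  have [measurable]: "(\<lambda>x. \<integral>\<^sup>+y. f (x(i := y)) \<partial>M i) \<in> borel_measurable (PiM (insert i J) M)"
  proof -
    have [measurable]: "(\<lambda>(x, y). x(i := y)) \<in> PiM I M \<Otimes>\<^sub>M M i \<rightarrow>\<^sub>M PiM I M"
      using measurable_fun_upd[of I I i fst "PiM I M \<Otimes>\<^sub>M M i" M snd] I(2)
      by (auto simp: insert_absorb split_beta')
    show ?thesis unfolding J(3)[symmetric] by measurable
  qed
  show ?thesis
    using f unfolding J(3)
    by (subst (1 2) product_nn_integral_insert[OF J(1,2)]) (auto simp: i.emeasure_space_1)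
qed

text \<open>The moving interval is turned into a condition on the integrand, which reduces the claim
  to joint measurability.\<close>

lemma measurable_nn_integral_Ioo:
  fixes l m :: "'a \<Rightarrow> real"
  assumes [measurable]: "l \<in> borel_measurable M" "m \<in> borel_measurable M"
    and F[measurable]: "(\<lambda>(w, z). F w z) \<in> borel_measurable (M \<Otimes>\<^sub>M borel)"
  shows "(\<lambda>w. \<integral>\<^sup>+z\<in>{l w<..<m w}. F w z \<partial>lborel) \<in> borel_measurable M"
proof -
  have "(\<lambda>w. \<integral>\<^sup>+z\<in>{l w<..<m w}. F w z \<partial>lborel) =
    (\<lambda>w. \<integral>\<^sup>+z. (if l w < z \<and> z < m w then F w z else 0) \<partial>lborel)"
    by (intro ext nn_integral_cong) (simp add: indicator_def)
  also have "\<dots> \<in> borel_measurable M"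
    by measurable
  finally show ?thesis .
qed

lemma nn_integral_Ioo_split_le:
  fixes F :: "real \<Rightarrow> ennreal"
  assumes [measurable]: "F1 \<in> borel_measurable borel" "F2 \<in> borel_measurable borel"
    and "a \<le> y" "y \<le> b"
    and "\<And>z. a < z \<Longrightarrow> z < y \<Longrightarrow> F1 z \<le> F z" "\<And>z. y < z \<Longrightarrow> z < b \<Longrightarrow> F2 z \<le> F z"
  shows "(\<integral>\<^sup>+z\<in>{a<..<y}. F1 z \<partial>lborel) + (\<integral>\<^sup>+z\<in>{y<..<b}. F2 z \<partial>lborel)
    \<le> (\<integral>\<^sup>+z\<in>{a<..<b}. F z \<partial>lborel)"
proof -
  have "(\<integral>\<^sup>+z\<in>{a<..<y}. F1 z \<partial>lborel) + (\<integral>\<^sup>+z\<in>{y<..<b}. F2 z \<partial>lborel)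
    = (\<integral>\<^sup>+z. F1 z * indicator {a<..<y} z + F2 z * indicator {y<..<b} z \<partial>lborel)"
    by (rule nn_integral_add[symmetric]) measurable
  also have "\<dots> \<le> (\<integral>\<^sup>+z\<in>{a<..<b}. F z \<partial>lborel)"
    using assms(3-) by (intro nn_integral_mono) (auto simp: indicator_def)
  finally show ?thesis .
qed

text \<open>Each pivot preserves the expected integral of the clipped function and contracts the
  expected total area by \<open>5 / 6\<close>; after the last pivot the loss is at most the area.
  Interval, bounds and function may depend on the seeds; their invariance under changes of the
  \<open>T\<close> seeds from \<open>i\<close> on says that they depend on other seeds only.\<close>

lemma nn_integral_search:
  fixes N T i :: nat and a b lo hi :: "(nat \<Rightarrow> real) \<Rightarrow> real"
  assumes R_def: "R = PiM {..<N} (\<lambda>_. unit_uniform)"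
    and g: "(\<lambda>(r, z). g r z) \<in> borel_measurable (R \<Otimes>\<^sub>M borel)"
    and "i + T \<le> N"
    and "a \<in> borel_measurable R" "b \<in> borel_measurable R"
    and "lo \<in> borel_measurable R" "hi \<in> borel_measurable R"
    and "\<forall>r j u. i \<le> j \<longrightarrow> j < i + T \<longrightarrow> a (r(j := u)) = a r \<and> b (r(j := u)) = b r \<and>
        lo (r(j := u)) = lo r \<and> hi (r(j := u)) = hi r \<and> g (r(j := u)) = g r"
    and "\<forall>r\<in>space R. a r < b r \<and> 0 \<le> lo r \<and> lo r \<le> hi r"
  shows "(\<integral>\<^sup>+r. (\<integral>\<^sup>+z\<in>{a r<..<b r}. ennreal (clip (lo r) (hi r) (g r z)) \<partial>lborel) \<partial>R)
    \<le> (\<integral>\<^sup>+r. (\<integral>\<^sup>+z\<in>{a r<..<b r}.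
          ennreal (search T i r (g r) (a r) (b r) (lo r) (hi r) z) \<partial>lborel) \<partial>R)
      + ennreal ((5 / 6) ^ T) * (\<integral>\<^sup>+r. ennreal ((b r - a r) * (hi r - lo r)) \<partial>R)"
  \<comment> \<open>The default bound is too small to unify the goal with the induction rule.\<close>
  using [[unify_search_bound = 200]] assms(3-)
proof (induction T arbitrary: i a b lo hi)
  case 0
  note [measurable] = g "0.prems"(2-5)
  have [measurable]: "(\<lambda>r. \<integral>\<^sup>+z\<in>{a r<..<b r}. ennreal (lo r) \<partial>lborel) \<in> borel_measurable R"
    by (rule measurable_nn_integral_Ioo) measurable
  \<comment> \<open>Without pivots the output is \<open>lo\<close>, while the clipped function is at
    most \<open>hi\<close>; the gap integrates to at most the area of the box.\<close>
  have "(\<integral>\<^sup>+r. (\<integral>\<^sup>+z\<in>{a r<..<b r}. ennreal (clip (lo r) (hi r) (g r z)) \<partial>lborel) \<partial>R)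
    \<le> (\<integral>\<^sup>+r. ((\<integral>\<^sup>+z\<in>{a r<..<b r}. ennreal (lo r) \<partial>lborel)
      + ennreal ((b r - a r) * (hi r - lo r))) \<partial>R)"
  proof (rule nn_integral_mono)
    fix r assume "r \<in> space R"
    then have r: "a r < b r" "0 \<le> lo r" "lo r \<le> hi r"
      using "0.prems"(7) by auto
    have "(\<integral>\<^sup>+z\<in>{a r<..<b r}. ennreal (clip (lo r) (hi r) (g r z)) \<partial>lborel)
      \<le> (\<integral>\<^sup>+z\<in>{a r<..<b r}. ennreal (hi r) \<partial>lborel)"
      using clip_bounds[OF r(3)] by (intro nn_integral_mono mult_right_mono ennreal_leI) auto
    also have "\<dots> = ennreal (hi r * (b r - a r))"
      using r by (simp add: nn_integral_cmult_indicator ennreal_mult)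
    also have "hi r * (b r - a r) = lo r * (b r - a r) + (b r - a r) * (hi r - lo r)"
      by (simp add: algebra_simps)
    also have "ennreal \<dots> = (\<integral>\<^sup>+z\<in>{a r<..<b r}. ennreal (lo r) \<partial>lborel)
        + ennreal ((b r - a r) * (hi r - lo r))"
      using r by (simp add: nn_integral_cmult_indicator ennreal_mult)
    finally show "(\<integral>\<^sup>+z\<in>{a r<..<b r}. ennreal (clip (lo r) (hi r) (g r z)) \<partial>lborel)
      \<le> (\<integral>\<^sup>+z\<in>{a r<..<b r}. ennreal (lo r) \<partial>lborel) + ennreal ((b r - a r) * (hi r - lo r))" .
  qed
  also have "\<dots> = (\<integral>\<^sup>+r. (\<integral>\<^sup>+z\<in>{a r<..<b r}. ennreal (lo r) \<partial>lborel) \<partial>R)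
      + (\<integral>\<^sup>+r. ennreal ((b r - a r) * (hi r - lo r)) \<partial>R)"
    by (rule nn_integral_add) measurable
  finally show ?case by simp
next
  case (Suc T)
  note [measurable] = g Suc.prems(2-5)
  have i: "i < N" using Suc.prems(1) by simp
  interpret U: prob_space unit_uniform by (rule prob_space_unit_uniform)
  interpret R: product_sigma_finite "\<lambda>_::nat. unit_uniform"
    by standard
  have [measurable]: "(\<lambda>r. r i) \<in> borel_measurable R"
    using i by (auto simp: R_def intro!: measurable_unit_uniform_component[of _ _ "{..<N}"])
  have inv: "a (r(j := u)) = a r \<and> b (r(j := u)) = b r \<and> lo (r(j := u)) = lo r \<and>
      hi (r(j := u)) = hi r \<and> g (r(j := u)) = g r" if "i \<le> j" "j < Suc i + T" for r j u
    using Suc.prems(6) that unfolding add_Suc_right add_Suc by blast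
  have bounds: "a r < b r \<and> 0 \<le> lo r \<and> lo r \<le> hi r" if "r \<in> space R" for r
    using Suc.prems(7) that by blast
  have ri: "0 < r i" "r i < 1" if "r \<in> space R" for r
    using that i by (auto simp: R_def space_PiM space_unit_uniform PiE_iff)
  define y where "y r = a r + r i * (b r - a r)" for r
  have y[measurable]: "y \<in> borel_measurable R"
    unfolding y_def by measurable
  define v where "v r = clip (lo r) (hi r) (g r (y r))" for r
  have v[measurable]: "v \<in> borel_measurable R"
    unfolding v_def by measurable
  have yb: "a r < y r" "y r < b r" if "r \<in> space R" for r
    using pivot_between[of "a r" "b r" "r i"] ri[OF that] bounds[OF that] by (auto simp: y_def)
  have vb: "0 \<le> v r" "lo r \<le> v r" "v r \<le> hi r" if "r \<in> space R" for r
    using bounds[OF that] clip_bounds[of "lo r" "hi r" "g r (y r)"] by (auto simp: v_def)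
  have yv_inv: "y (r(j := u)) = y r" "v (r(j := u)) = v r" if "Suc i \<le> j" "j < Suc i + T" for r j u
    using inv[of j r u] that by (auto simp: y_def v_def)
  have resample: "(\<integral>\<^sup>+r. f r \<partial>R) = (\<integral>\<^sup>+r. \<integral>\<^sup>+u. f (r(i := u)) \<partial>unit_uniform \<partial>R)"
    if "f \<in> borel_measurable R" for f
    using R.nn_integral_PiM_resample[of "{..<N}" i f] that i U.prob_space_axioms by (simp add: R_def)
  \<comment> \<open>\<open>L1\<close> and \<open>L2\<close> are the clipped integrals left and right
    of the pivot, \<open>S1\<close> and \<open>S2\<close> the searches there, \<open>w1\<close> and
    \<open>w2\<close> the areas of the new boxes.\<close>
  define L1 where "L1 r = (\<integral>\<^sup>+z\<in>{a r<..<y r}. ennreal (clip (lo r) (v r) (g r z)) \<partial>lborel)" for r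
  define L2 where "L2 r = (\<integral>\<^sup>+z\<in>{y r<..<b r}. ennreal (clip (v r) (hi r) (g r z)) \<partial>lborel)" for r
  have L[measurable]: "L1 \<in> borel_measurable R" "L2 \<in> borel_measurable R"
    unfolding L1_def L2_def by (rule measurable_nn_integral_Ioo; measurable)+
  define S1 where
    "S1 r z = search T (Suc i) r (g r) (a r) (y r) (lo r) (v r) z" for r z
  define S2 where
    "S2 r z = search T (Suc i) r (g r) (y r) (b r) (v r) (hi r) z" for r z
  have seed[measurable]: "(\<lambda>w. fst w j) \<in> borel_measurable (R \<Otimes>\<^sub>M borel)" if "j < N" for j
    using that by (auto simp: R_def intro!: measurable_unit_uniform_component[of _ _ "{..<N}"])
  have S[measurable]: "(\<lambda>(r, z). S1 r z) \<in> borel_measurable (R \<Otimes>\<^sub>M borel)"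
    "(\<lambda>(r, z). S2 r z) \<in> borel_measurable (R \<Otimes>\<^sub>M borel)"
    unfolding S1_def S2_def split_beta' using Suc.prems(1)
    by (intro measurable_search seed; simp; measurable)+
  define w1 where "w1 r = ennreal ((y r - a r) * (v r - lo r))" for r
  define w2 where "w2 r = ennreal ((b r - y r) * (hi r - v r))" for r
  have [measurable]: "w1 \<in> borel_measurable R" "w2 \<in> borel_measurable R"
    unfolding w1_def w2_def by measurable

  \<comment> \<open>Seed \<open>i\<close> influences neither the interval nor the bounds nor
    \<open>g\<close>, so redrawing it makes \<open>y\<close> a fresh uniform pivot and the one-step
    identity applies.\<close>
  have "(\<integral>\<^sup>+r. (\<integral>\<^sup>+z\<in>{a r<..<b r}. ennreal (clip (lo r) (hi r) (g r z)) \<partial>lborel) \<partial>R)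
    = (\<integral>\<^sup>+r. \<integral>\<^sup>+u. L1 (r(i := u)) + L2 (r(i := u)) \<partial>unit_uniform \<partial>R)"
  proof (rule nn_integral_cong)
    fix r assume r: "r \<in> space R"
    show "(\<integral>\<^sup>+z\<in>{a r<..<b r}. ennreal (clip (lo r) (hi r) (g r z)) \<partial>lborel)
      = (\<integral>\<^sup>+u. L1 (r(i := u)) + L2 (r(i := u)) \<partial>unit_uniform)"
      using bounds[OF r] r inv[of i r]
      by (subst nn_integral_search_step[symmetric])
         (auto simp: L1_def L2_def y_def v_def Let_def)
  qed
  also have "\<dots> = (\<integral>\<^sup>+r. L1 r + L2 r \<partial>R)"
    by (rule resample[symmetric]) measurable
  also have "\<dots> = (\<integral>\<^sup>+r. L1 r \<partial>R) + (\<integral>\<^sup>+r. L2 r \<partial>R)"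
    by (rule nn_integral_add) measurable
  \<comment> \<open>The induction hypothesis is applied to each side separately: the pivot and its
    value depend on seed \<open>i\<close>, but not on the seeds still to come.\<close>
  also have "\<dots> \<le> ((\<integral>\<^sup>+r. (\<integral>\<^sup>+z\<in>{a r<..<y r}. ennreal (S1 r z) \<partial>lborel) \<partial>R)
        + ennreal ((5 / 6) ^ T) * (\<integral>\<^sup>+r. w1 r \<partial>R))
      + ((\<integral>\<^sup>+r. (\<integral>\<^sup>+z\<in>{y r<..<b r}. ennreal (S2 r z) \<partial>lborel) \<partial>R)
        + ennreal ((5 / 6) ^ T) * (\<integral>\<^sup>+r. w2 r \<partial>R))"
    unfolding L1_def L2_def S1_def S2_def w1_def w2_def
  proof (intro add_mono Suc.IH)
    have *: "\<forall>r j u. Suc i \<le> j \<longrightarrow> j < Suc i + T \<longrightarrow>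
      (a (r(j := u)) = a r \<and> b (r(j := u)) = b r \<and> lo (r(j := u)) = lo r \<and>
       hi (r(j := u)) = hi r \<and> g (r(j := u)) = g r) \<and> y (r(j := u)) = y r \<and> v (r(j := u)) = v r"
      by (intro allI impI conjI[OF inv] conjI[OF yv_inv]) auto
    show "\<forall>r j u. Suc i \<le> j \<longrightarrow> j < Suc i + T \<longrightarrow> a (r(j := u)) = a r \<and> y (r(j := u)) = y r \<and>
      lo (r(j := u)) = lo r \<and> v (r(j := u)) = v r \<and> g (r(j := u)) = g r"
      "\<forall>r j u. Suc i \<le> j \<longrightarrow> j < Suc i + T \<longrightarrow> y (r(j := u)) = y r \<and> b (r(j := u)) = b r \<and>
      v (r(j := u)) = v r \<and> hi (r(j := u)) = hi r \<and> g (r(j := u)) = g r"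
      using * by blast+
    show "\<forall>r\<in>space R. a r < y r \<and> 0 \<le> lo r \<and> lo r \<le> v r"
      "\<forall>r\<in>space R. y r < b r \<and> 0 \<le> v r \<and> v r \<le> hi r"
      using bounds yb vb by auto
  qed (use Suc.prems(1-5) y v in simp_all)
  also have "\<dots> = (\<integral>\<^sup>+r. (\<integral>\<^sup>+z\<in>{a r<..<y r}. ennreal (S1 r z) \<partial>lborel)
        + (\<integral>\<^sup>+z\<in>{y r<..<b r}. ennreal (S2 r z) \<partial>lborel) \<partial>R)
      + ennreal ((5 / 6) ^ T) * (\<integral>\<^sup>+r. w1 r + w2 r \<partial>R)"
  proof -
    have "(\<lambda>r. \<integral>\<^sup>+z\<in>{a r<..<y r}. ennreal (S1 r z) \<partial>lborel) \<in> borel_measurable R"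
      "(\<lambda>r. \<integral>\<^sup>+z\<in>{y r<..<b r}. ennreal (S2 r z) \<partial>lborel) \<in> borel_measurable R"
      by (rule measurable_nn_integral_Ioo; measurable)+
    then show ?thesis
      by (simp add: nn_integral_add distrib_left add.assoc add.left_commute)
  qed
  \<comment> \<open>On each side of the pivot the longer search continues as the corresponding
    shorter one. The areas contract by redrawing seed \<open>i\<close> once more.\<close>
  also have "\<dots> \<le> (\<integral>\<^sup>+r. (\<integral>\<^sup>+z\<in>{a r<..<b r}.
          ennreal (search (Suc T) i r (g r) (a r) (b r) (lo r) (hi r) z) \<partial>lborel) \<partial>R)
      + ennreal ((5 / 6) ^ T) * (ennreal (5 / 6) * (\<integral>\<^sup>+r. ennreal ((b r - a r) * (hi r - lo r)) \<partial>R))"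
  proof (intro add_mono mult_left_mono)
    show "(\<integral>\<^sup>+r. (\<integral>\<^sup>+z\<in>{a r<..<y r}. ennreal (S1 r z) \<partial>lborel)
        + (\<integral>\<^sup>+z\<in>{y r<..<b r}. ennreal (S2 r z) \<partial>lborel) \<partial>R)
      \<le> (\<integral>\<^sup>+r. (\<integral>\<^sup>+z\<in>{a r<..<b r}.
          ennreal (search (Suc T) i r (g r) (a r) (b r) (lo r) (hi r) z) \<partial>lborel) \<partial>R)"
    proof (rule nn_integral_mono)
      fix r assume r: "r \<in> space R"
      have Sr: "S1 r \<in> borel_measurable borel" "S2 r \<in> borel_measurable borel"
        using measurable_Pair2[OF S(1) r] measurable_Pair2[OF S(2) r] by auto
      show "(\<integral>\<^sup>+z\<in>{a r<..<y r}. ennreal (S1 r z) \<partial>lborel)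
          + (\<integral>\<^sup>+z\<in>{y r<..<b r}. ennreal (S2 r z) \<partial>lborel)
        \<le> (\<integral>\<^sup>+z\<in>{a r<..<b r}.
          ennreal (search (Suc T) i r (g r) (a r) (b r) (lo r) (hi r) z) \<partial>lborel)"
        using yb[OF r]
        by (intro nn_integral_Ioo_split_le measurable_compose[OF Sr(1) measurable_ennreal]
            measurable_compose[OF Sr(2) measurable_ennreal])
           (auto simp: Let_def S1_def S2_def simp flip: y_def v_def)
    qed
    have "(\<integral>\<^sup>+r. w1 r + w2 r \<partial>R)
      = (\<integral>\<^sup>+r. \<integral>\<^sup>+u. w1 (r(i := u)) + w2 (r(i := u)) \<partial>unit_uniform \<partial>R)"
      by (rule resample) measurable
    also have "\<dots> \<le> (\<integral>\<^sup>+r. ennreal (5 / 6) * ennreal ((b r - a r) * (hi r - lo r)) \<partial>R)"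
    proof (rule nn_integral_mono)
      fix r assume r: "r \<in> space R"
      have "(\<integral>\<^sup>+u. w1 (r(i := u)) + w2 (r(i := u)) \<partial>unit_uniform)
        = (\<integral>\<^sup>+u. (let y = a r + u * (b r - a r); v = clip (lo r) (hi r) (g r y) in
            ennreal ((y - a r) * (v - lo r) + (b r - y) * (hi r - v))) \<partial>unit_uniform)"
      proof (rule nn_integral_cong)
        fix u assume "u \<in> space unit_uniform"
        then have u: "0 < u" "u < 1" by (auto simp: space_unit_uniform)
        show "w1 (r(i := u)) + w2 (r(i := u)) =
          (let y = a r + u * (b r - a r); v = clip (lo r) (hi r) (g r y) in
            ennreal ((y - a r) * (v - lo r) + (b r - y) * (hi r - v)))"
          using inv[of i r u] pivot_between[of "a r" "b r" u] u bounds[OF r]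
            clip_bounds[of "lo r" "hi r"]
          by (simp add: w1_def w2_def y_def v_def Let_def ennreal_plus del: add_diff_cancel_left')
      qed
      also have "\<dots> \<le> ennreal (5 / 6 * ((b r - a r) * (hi r - lo r)))"
        using bounds[OF r] by (intro nn_integral_search_step_width) auto
      finally show "(\<integral>\<^sup>+u. w1 (r(i := u)) + w2 (r(i := u)) \<partial>unit_uniform)
        \<le> ennreal (5 / 6) * ennreal ((b r - a r) * (hi r - lo r))"
        using bounds[OF r] by (subst ennreal_mult[symmetric]) auto
    qed
    also have "\<dots> = ennreal (5 / 6) * (\<integral>\<^sup>+r. ennreal ((b r - a r) * (hi r - lo r)) \<partial>R)"
      by (rule nn_integral_cmult) measurable
    finally show "(\<integral>\<^sup>+r. w1 r + w2 r \<partial>R)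
      \<le> ennreal (5 / 6) * (\<integral>\<^sup>+r. ennreal ((b r - a r) * (hi r - lo r)) \<partial>R)" .
  qed auto
  also have "ennreal ((5 / 6) ^ T) * (ennreal (5 / 6) * (\<integral>\<^sup>+r. ennreal ((b r - a r) * (hi r - lo r)) \<partial>R))
    = ennreal ((5 / 6) ^ Suc T) * (\<integral>\<^sup>+r. ennreal ((b r - a r) * (hi r - lo r)) \<partial>R)"
  proof -
    have "ennreal ((5 / 6) ^ Suc T) = ennreal ((5 / 6) ^ T) * ennreal (5 / 6)"
      by (subst ennreal_mult[symmetric]) (auto simp: mult.commute)
    then show ?thesis by (simp only: mult.assoc)
  qed
  finally show ?case .
qed

section \<open>Quantiles and randomized distribution functions\<close>

text \<open>The value outside \<open>(0, 1)\<close>, where the infimum is junk, only serves measurability.\<close>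

definition quantile :: "real measure \<Rightarrow> real \<Rightarrow> real" where
  "quantile D z = (if 0 < z \<and> z < 1 then Inf {x. z \<le> cdf D x} else 0)"

text \<open>The distributional transform: \<open>s\<close> chooses a position inside the jump of the
  distribution function at \<open>x\<close>. For uniform \<open>s\<close> and \<open>x\<close> drawn
  from \<open>D\<close> the result is uniform even if \<open>D\<close> has atoms.\<close>

definition rand_cdf :: "real measure \<Rightarrow> real \<Rightarrow> real \<Rightarrow> real" where
  "rand_cdf D x s = measure D {..<x} + s * (cdf D x - measure D {..<x})"

text \<open>For \<open>t < t'\<close> the closed ray at \<open>t\<close> lies in the open ray at
  \<open>t'\<close>, so letting \<open>t'\<close> decrease to \<open>t\<close> carries the upper
  bound over to closed rays. Stating the two bounds for different rays avoids having to exclude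
  atoms beforehand.\<close>

lemma cdf_of_unit_uniform_bounds:
  assumes "real_distribution \<nu>"
    and lower: "\<And>t. 0 < t \<Longrightarrow> t < 1 \<Longrightarrow> t \<le> measure \<nu> {..t}"
    and upper: "\<And>t. 0 < t \<Longrightarrow> t < 1 \<Longrightarrow> measure \<nu> {..<t} \<le> t"
  shows "cdf \<nu> t = max 0 (min 1 t)"
proof -
  interpret real_distribution \<nu> by fact
  have less: "measure \<nu> {..t} \<le> t'" if "t < t'" "0 < t'" "t' < 1" for t'
  proof -
    have "measure \<nu> {..t} \<le> measure \<nu> {..<t'}"
      using that by (intro finite_measure_mono) auto
    then show ?thesis using upper[of t'] that by simp
  qed
  have greater: "t' \<le> measure \<nu> {..t}" if "t' \<le> t" "0 < t'" "t' < 1" for t'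
  proof -
    have "measure \<nu> {..t'} \<le> measure \<nu> {..t}"
      using that by (intro finite_measure_mono) auto
    then show ?thesis using lower[of t'] that by simp
  qed
  consider "t \<le> 0" | "0 < t" "t < 1" | "1 \<le> t" by linarith
  then show ?thesis
  proof cases
    case 1
    have "measure \<nu> {..t} \<le> 0"
      by (rule dense_ge_bounded[of 0 1]) (use less 1 in auto)
    then show ?thesis using 1 measure_nonneg[of \<nu> "{..t}"] by (simp add: cdf_def)
  next
    case 2
    have "measure \<nu> {..t} \<le> t"
      by (rule dense_ge_bounded[of t 1]) (use less 2 in auto)
    then show ?thesis using 2 greater[of t] by (simp add: cdf_def)
  next
    case 3
    have "1 \<le> measure \<nu> {..t}"
      by (rule dense_le_bounded[of 0 1]) (use greater 3 in auto)
    then show ?thesis using 3 prob_le_1[of "{..t}"] by (simp add: cdf_def)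
  qed
qed

lemma emeasure_unit_uniform:
  "A \<in> sets borel \<Longrightarrow> A \<subseteq> {0<..<1} \<Longrightarrow> emeasure unit_uniform A = emeasure lborel A"
  unfolding unit_uniform_def by (subst emeasure_restrict_space) auto

lemma real_distribution_unit_uniform: "real_distribution (distr unit_uniform borel (\<lambda>u. u))"
  by (auto intro!: prob_space.real_distribution_distr prob_space_unit_uniform measurable_unit_uniform)

lemma distr_unit_uniformI:
  assumes "real_distribution \<nu>"
    and "\<And>t. 0 < t \<Longrightarrow> t < 1 \<Longrightarrow> t \<le> measure \<nu> {..t}"
    and "\<And>t. 0 < t \<Longrightarrow> t < 1 \<Longrightarrow> measure \<nu> {..<t} \<le> t"
  shows "\<nu> = distr unit_uniform borel (\<lambda>u. u)"
proof (rule cdf_unique)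
  let ?U = "distr unit_uniform borel (\<lambda>u. u)"
  have 1: "{..t} \<inter> {0<..<1} = {0<..t}" "{..<t} \<inter> {0<..<1} = {0<..<t}" if "0 < t" "t < 1" for t :: real
    using that by auto
  have 2: "{0<..t} \<subseteq> {0<..<1}" "{0<..<t} \<subseteq> {0<..<1}" if "0 < t" "t < 1" for t :: real
    using that by auto
  have "measure ?U {..t} = t" "measure ?U {..<t} = t" if "0 < t" "t < 1" for t
    using that
    by (auto simp: measure_def emeasure_distr space_unit_uniform 1 2 emeasure_unit_uniform
        measurable_unit_uniform)
  then show "cdf \<nu> = cdf ?U"
    using cdf_of_unit_uniform_bounds[OF assms]
      cdf_of_unit_uniform_bounds[OF real_distribution_unit_uniform] by (auto simp: fun_eq_iff)
qed (use assms(1) real_distribution_unit_uniform in auto)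

context real_distribution
begin

interpretation cdf_distribution M
  by unfold_locales

lemma quantile_le_iff: "0 < z \<Longrightarrow> z < 1 \<Longrightarrow> quantile M z \<le> x \<longleftrightarrow> z \<le> cdf M x"
  using pseudoinverse[of z x] by (simp add: quantile_def)

lemma measurable_quantile [measurable]: "quantile M \<in> borel_measurable borel"
proof -
  have "(\<lambda>z. if z \<in> {0<..<1} then Inf {x. z \<le> cdf M x} else 0) \<in> borel_measurable borel"
    by (rule measurable_restrict_space_iff[THEN iffD1, OF _ _ measurable_CI]) auto
  then show ?thesis by (simp add: quantile_def[abs_def])
qed

text \<open>Inverse transform sampling; the junk values of \<open>quantile\<close> lie outside the
  space of \<open>unit_uniform\<close>.\<close>

lemma nn_integral_quantile:
  assumes [measurable]: "f \<in> borel_measurable borel"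
  shows "(\<integral>\<^sup>+z. f (quantile M z) \<partial>unit_uniform) = (\<integral>\<^sup>+x. f x \<partial>M)"
proof -
  have "(\<integral>\<^sup>+z. f (quantile M z) \<partial>unit_uniform) = (\<integral>\<^sup>+z. f (Inf {x. z \<le> cdf M x}) \<partial>unit_uniform)"
    by (intro nn_integral_cong) (auto simp: quantile_def space_unit_uniform)
  also have "\<dots> = (\<integral>\<^sup>+x. f x \<partial>distr unit_uniform borel (\<lambda>z. Inf {x. z \<le> cdf M x}))"
    using measurable_CI
    by (subst nn_integral_distr) (auto simp: unit_uniform_def cong: measurable_cong_sets)
  also have "\<dots> = (\<integral>\<^sup>+x. f x \<partial>M)"
    using distr_I_eq_M by (simp add: unit_uniform_def)
  finally show ?thesis .
qed

lemma measure_lessThan_le_cdf: "x < y \<Longrightarrow> cdf M x \<le> measure M {..<y}"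
  unfolding cdf_def by (intro finite_measure_mono) auto

lemma cdf_split: "cdf M x = measure M {..<x} + measure M {x}"
  unfolding cdf_def ivl_disj_un(2)[symmetric] by (subst finite_measure_Union) auto

lemma rand_cdf_bounds:
  assumes "0 \<le> s" "s \<le> 1"
  shows "measure M {..<x} \<le> rand_cdf M x s" "rand_cdf M x s \<le> cdf M x"
proof -
  show "measure M {..<x} \<le> rand_cdf M x s"
    using assms by (simp add: rand_cdf_def cdf_split)
  have "s * measure M {x} \<le> 1 * measure M {x}"
    using assms by (intro mult_right_mono) auto
  then show "rand_cdf M x s \<le> cdf M x"
    by (simp add: rand_cdf_def cdf_split)
qed

text \<open>For \<open>x < y\<close> the jump at \<open>x\<close> ends no higher than the jump at
  \<open>y\<close> starts, so \<open>cdf M x \<le> measure M {..<y}\<close> separates the two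
  values.\<close>

lemma rand_cdf_mono:
  assumes "0 \<le> s" "s \<le> 1" "x \<le> y"
  shows "rand_cdf M x s \<le> rand_cdf M y s"
proof (cases "x = y")
  case False
  then show ?thesis
    using assms rand_cdf_bounds(2)[of s x] rand_cdf_bounds(1)[of s y]
      measure_lessThan_le_cdf[of x y] by linarith
qed simp

text \<open>Behind feasibility: pivots not exceeding the transformed input are sent by the quantile
  function to points not exceeding the input itself.\<close>

lemma quantile_le_of_le_rand_cdf:
  assumes "0 < z" "z < 1" "z \<le> rand_cdf M x s" "0 \<le> s" "s \<le> 1"
  shows "quantile M z \<le> x"
  using assms rand_cdf_bounds(2)[of s x] by (simp add: quantile_le_iff)

lemma measurable_rand_cdf [measurable (raw)]:
  assumes [measurable]: "f \<in> borel_measurable N" "g \<in> borel_measurable N"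
  shows "(\<lambda>w. rand_cdf M (f w) (g w)) \<in> borel_measurable N"
proof -
  have [measurable]: "(\<lambda>x. measure M {..<x}) \<in> borel_measurable borel"
    by (intro borel_measurable_mono monoI finite_measure_mono) auto
  note measurable_C[measurable]
  show ?thesis
    unfolding rand_cdf_def by measurable
qed

text \<open>Fix \<open>t\<close> and let \<open>x0\<close> be its quantile. Inputs below
  \<open>x0\<close> give values at most \<open>t\<close>, inputs above it values at least
  \<open>t\<close>, and at \<open>x0\<close> the positions \<open>s\<close> below \<open>p\<close>
  stay below or at \<open>t\<close>. Hence both one-sided probabilities compare with
  \<open>a + p * c = t\<close>.\<close>

lemma nn_integral_rand_cdf:
  assumes [measurable]: "f \<in> borel_measurable borel"
  shows "(\<integral>\<^sup>+x. \<integral>\<^sup>+s. f (rand_cdf M x s) \<partial>unit_uniform \<partial>M) = (\<integral>\<^sup>+z. f z \<partial>unit_uniform)"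
proof -
  interpret U: prob_space unit_uniform by (rule prob_space_unit_uniform)
  interpret P: pair_prob_space M unit_uniform ..
  have [measurable]: "snd \<in> borel_measurable (M \<Otimes>\<^sub>M unit_uniform)"
    by (rule measurable_compose[OF measurable_snd measurable_unit_uniform])
  define q where "q = (\<lambda>(x, s). rand_cdf M x s)"
  have q[measurable]: "q \<in> borel_measurable (M \<Otimes>\<^sub>M unit_uniform)"
    unfolding q_def by measurable
  define \<nu> where "\<nu> = distr (M \<Otimes>\<^sub>M unit_uniform) borel q"
  have \<nu>: "real_distribution \<nu>"
    unfolding \<nu>_def by (intro P.real_distribution_distr q)
  then interpret \<nu>: real_distribution \<nu> .
  have emeasure_\<nu>: "emeasure \<nu> A = (\<integral>\<^sup>+x. emeasure unit_uniform {s\<in>{0<..<1}. rand_cdf M x s \<in> A} \<partial>M)"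
    if "A \<in> sets borel" for A
  proof -
    have "emeasure \<nu> A = emeasure (M \<Otimes>\<^sub>M unit_uniform) (q -` A \<inter> space (M \<Otimes>\<^sub>M unit_uniform))"
      using that by (simp add: \<nu>_def emeasure_distr)
    also have "\<dots> = (\<integral>\<^sup>+x. emeasure unit_uniform
        (Pair x -` (q -` A \<inter> space (M \<Otimes>\<^sub>M unit_uniform))) \<partial>M)"
      using that by (intro U.emeasure_pair_measure_alt measurable_sets[OF q]) auto
    also have "\<dots> = (\<integral>\<^sup>+x. emeasure unit_uniform {s\<in>{0<..<1}. rand_cdf M x s \<in> A} \<partial>M)"
      by (intro nn_integral_cong arg_cong[where f="emeasure unit_uniform"])
         (auto simp: space_pair_measure space_unit_uniform q_def)
    finally show ?thesis .
  qed
  have sets_U: "{s\<in>{0<..<1}. rand_cdf M x s \<in> A} \<in> sets borel" if "A \<in> sets borel" for x A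
    using that by measurable
  have bounds: "ennreal t \<le> emeasure \<nu> {..t} \<and> emeasure \<nu> {..<t} \<le> ennreal t" if t: "0 < t" "t < 1" for t
  proof -
    define x0 where "x0 = quantile M t"
    define a where "a = measure M {..<x0}"
    define c where "c = measure M {x0}"
    have cdf: "cdf M x0 = a + c"
      by (simp add: cdf_split a_def c_def)
    have "0 \<le> a" "0 \<le> c" by (auto simp: a_def c_def)
    have upper: "t \<le> a + c"
      using quantile_le_iff[OF t, of x0] by (simp add: x0_def cdf[unfolded x0_def])
    \<comment> \<open>Left of \<open>x0\<close> the distribution function is at most
      \<open>t\<close> by the choice of \<open>x0\<close>, hence so is its left limit
      \<open>a\<close>.\<close>
    have lower: "a \<le> t"
      unfolding a_def
    proof (rule tendsto_upperbound[OF cdf_at_left])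
      show "eventually (\<lambda>x. cdf M x \<le> t) (at_left x0)"
      proof (rule eventually_at_leftI)
        show "cdf M x \<le> t" if "x \<in> {x0 - 1<..<x0}" for x
          using quantile_le_iff[OF t, of x] that by (simp add: x0_def)
      qed simp
    qed simp
    \<comment> \<open>The share of the atom at \<open>x0\<close> needed to reach \<open>t\<close>.
      If \<open>c = 0\<close>, then \<open>a = t\<close>, and the value 0 keeps
      \<open>p * c = t - a\<close> true.\<close>
    define p where "p = (if c = 0 then 0 else (t - a) / c)"
    have p: "0 \<le> p" "p \<le> 1" "p * c = t - a"
      using upper lower \<open>0 \<le> c\<close> by (auto simp: p_def field_simps)
    have Up: "emeasure unit_uniform {0<..<p} = ennreal p"
      using p by (subst emeasure_unit_uniform) auto
    have at_x0: "rand_cdf M x0 s = a + s * c" for s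
      by (simp add: rand_cdf_def cdf a_def)
    have total: "(\<integral>\<^sup>+x. indicator {..<x0} x + ennreal p * indicator {x0} x \<partial>M) = ennreal t"
    proof -
      have "(\<integral>\<^sup>+x. indicator {..<x0} x + ennreal p * indicator {x0} x \<partial>M) =
        ennreal a + ennreal p * ennreal c"
        by (subst nn_integral_add) (auto simp: nn_integral_cmult_indicator emeasure_eq_measure a_def c_def)
      also have "\<dots> = ennreal (a + p * c)"
        using p(1) \<open>0 \<le> a\<close> \<open>0 \<le> c\<close>
        by (simp only: ennreal_mult ennreal_plus mult_nonneg_nonneg)
      finally show ?thesis using p by simp
    qed
    \<comment> \<open>Lower bound for the closed ray: below \<open>x0\<close> all positions count,
      at \<open>x0\<close> at least those in \<open>(0, p)\<close>.\<close>
    have "(\<integral>\<^sup>+x. indicator {..<x0} x + ennreal p * indicator {x0} x \<partial>M) \<le>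
      (\<integral>\<^sup>+x. emeasure unit_uniform {s\<in>{0<..<1}. rand_cdf M x s \<in> {..t}} \<partial>M)"
    proof (rule nn_integral_mono)
      fix x
      consider "x < x0" | "x = x0" | "x > x0" by linarith
      then show "indicator {..<x0} x + ennreal p * indicator {x0} x \<le>
        emeasure unit_uniform {s\<in>{0<..<1}. rand_cdf M x s \<in> {..t}}"
      proof cases
        case 1
        have "rand_cdf M x s \<le> t" if "0 < s" "s < 1" for s
          using rand_cdf_bounds(2)[of s x] that measure_lessThan_le_cdf[OF 1] lower
          by (simp add: a_def)
        then have "{s\<in>{0<..<1}. rand_cdf M x s \<in> {..t}} = space unit_uniform"
          by (auto simp: space_unit_uniform)
        then show ?thesis using 1 by (simp add: U.emeasure_space_1)
      next
        case 2
        have "{0<..<p} \<subseteq> {s\<in>{0<..<1}. rand_cdf M x s \<in> {..t}}"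
        proof
          fix s assume s: "s \<in> {0<..<p}"
          then have "s * c \<le> p * c" using \<open>0 \<le> c\<close> by (intro mult_right_mono) auto
          then show "s \<in> {s\<in>{0<..<1}. rand_cdf M x s \<in> {..t}}"
            using s p by (simp add: 2 at_x0)
        qed
        then have "emeasure unit_uniform {0<..<p} \<le>
          emeasure unit_uniform {s\<in>{0<..<1}. rand_cdf M x s \<in> {..t}}"
          using sets_U[of "{..t}" x]
          by (intro emeasure_mono) (auto simp: unit_uniform_def sets_restrict_space_iff)
        then show ?thesis using 2 by (simp add: Up)
      qed auto
    qed
    \<comment> \<open>Upper bound for the open ray: at \<open>x0\<close> only positions in
      \<open>(0, p)\<close> fall strictly below \<open>t\<close>, above \<open>x0\<close> none
      do.\<close>
    moreover have "(\<integral>\<^sup>+x. emeasure unit_uniform {s\<in>{0<..<1}. rand_cdf M x s \<in> {..<t}} \<partial>M) \<le>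
      (\<integral>\<^sup>+x. indicator {..<x0} x + ennreal p * indicator {x0} x \<partial>M)"
    proof (rule nn_integral_mono)
      fix x
      consider "x < x0" | "x = x0" | "x > x0" by linarith
      then show "emeasure unit_uniform {s\<in>{0<..<1}. rand_cdf M x s \<in> {..<t}} \<le>
        indicator {..<x0} x + ennreal p * indicator {x0} x"
      proof cases
        case 1
        then show ?thesis by (simp add: U.emeasure_le_1)
      next
        case 2
        have "{s\<in>{0<..<1}. rand_cdf M x s \<in> {..<t}} \<subseteq> {0<..<p}"
        proof
          fix s assume "s \<in> {s\<in>{0<..<1}. rand_cdf M x s \<in> {..<t}}"
          then have s: "s \<in> {0<..<1}" "rand_cdf M x s \<in> {..<t}" by auto
          then have "s * c < p * c" using p by (simp add: 2 at_x0)
          then show "s \<in> {0<..<p}" using s \<open>0 \<le> c\<close> by (auto simp: mult_less_cancel_right)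
        qed
        then have "emeasure unit_uniform {s\<in>{0<..<1}. rand_cdf M x s \<in> {..<t}} \<le>
          emeasure unit_uniform {0<..<p}"
          using p by (intro emeasure_mono) (auto simp: unit_uniform_def sets_restrict_space_iff)
        then show ?thesis using 2 by (simp add: Up)
      next
        case 3
        have "t \<le> rand_cdf M x s" if "0 < s" "s < 1" for s
          using rand_cdf_bounds(1)[of s x] that measure_lessThan_le_cdf[OF 3] upper
          by (simp add: cdf)
        then have "{s\<in>{0<..<1}. rand_cdf M x s \<in> {..<t}} = {}"
          using leD by fastforce
        then show ?thesis by (simp only: emeasure_empty zero_le)
      qed
    qed
    ultimately show ?thesis
      by (simp add: emeasure_\<nu> total)
  qed
  have "\<nu> = distr unit_uniform borel (\<lambda>u. u)"
  proof (rule distr_unit_uniformI[OF \<nu>])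
    fix t :: real assume "0 < t" "t < 1"
    from bounds[OF this] \<open>0 < t\<close> show "t \<le> measure \<nu> {..t}" "measure \<nu> {..<t} \<le> t"
      by (auto simp: \<nu>.emeasure_eq_measure)
  qed
  then have "(\<integral>\<^sup>+z. f z \<partial>\<nu>) = (\<integral>\<^sup>+z. f z \<partial>unit_uniform)"
    by (simp add: nn_integral_distr measurable_unit_uniform)
  moreover have "(\<integral>\<^sup>+z. f z \<partial>\<nu>) = (\<integral>\<^sup>+x. \<integral>\<^sup>+s. f (rand_cdf M x s) \<partial>unit_uniform \<partial>M)"
    unfolding \<nu>_def by (subst nn_integral_distr) (auto simp: q_def U.nn_integral_fst[symmetric])
  ultimately show ?thesis by simp
qed

end

section \<open>Composition over the coordinates\<close>

primrec bind_tree :: "'p query_tree \<Rightarrow> (real \<Rightarrow> 'p query_tree) \<Rightarrow> 'p query_tree" where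
  "bind_tree (Output v) c = c v"
| "bind_tree (Query p k) c = Query p (\<lambda>v. bind_tree (k v) c)"

lemma answer_bind_tree: "answer (bind_tree t c) f = answer (c (answer t f)) f"
  by (induction t) auto

lemma queries_bind_tree: "queries (bind_tree t c) f = queries t f @ queries (c (answer t f)) f"
  by (induction t) auto

text \<open>Mirrors \<open>search\<close>, with the value at the pivot computed by a query tree
  \<open>G y\<close>, so that the procedure for the earlier coordinates can serve as the oracle for
  the next one.\<close>

primrec search_tree ::
  "nat \<Rightarrow> nat \<Rightarrow> (nat \<Rightarrow> real) \<Rightarrow> (real \<Rightarrow> 'p query_tree) \<Rightarrow>
    real \<Rightarrow> real \<Rightarrow> real \<Rightarrow> real \<Rightarrow> real \<Rightarrow> 'p query_tree" where
  "search_tree 0 i r G a b lo hi x = Output lo"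
| "search_tree (Suc T) i r G a b lo hi x =
     (let y = a + r i * (b - a) in bind_tree (G y) (\<lambda>w. let v = clip lo hi w in
       if y \<le> x then search_tree T (Suc i) r G y b v hi x else search_tree T (Suc i) r G a y lo v x))"

lemma answer_search_tree:
  "answer (search_tree T i r G a b lo hi x) f = search T i r (\<lambda>z. answer (G z) f) a b lo hi x"
  by (induction T arbitrary: i a b lo hi) (auto simp: Let_def answer_bind_tree)

text \<open>Each of the \<open>T\<close> levels on the path of \<open>x\<close> runs one tree
  \<open>G y\<close>.\<close>

lemma length_queries_search_tree:
  assumes "\<And>z. length (queries (G z) f) \<le> K"
  shows "length (queries (search_tree T i r G a b lo hi x) f) \<le> T * K"
proof (induction T arbitrary: i a b lo hi)
  case (Suc T)
  show ?case
    using assms Suc.IH by (auto simp: Let_def queries_bind_tree intro!: add_mono)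
qed simp

lemma queries_search_tree_subset:
  assumes "\<And>z. set (queries (G z) f) \<subseteq> X"
  shows "set (queries (search_tree T i r G a b lo hi x) f) \<subseteq> X"
proof (induction T arbitrary: i a b lo hi)
  case (Suc T)
  show ?case
    using assms Suc.IH by (simp add: Let_def queries_bind_tree)
qed simp

text \<open>
  Coordinate \<open>k\<close> uses the block of seeds from index \<open>k * Suc T\<close> on: the first one randomizes the
  distribution function at its atoms, the following \<open>T\<close> choose the pivots.
\<close>

primrec monotonize ::
  "(nat \<Rightarrow> real measure) \<Rightarrow> nat \<Rightarrow> ((nat \<Rightarrow> real) \<Rightarrow> real) \<Rightarrow> nat \<Rightarrow> (nat \<Rightarrow> real) \<Rightarrow> (nat \<Rightarrow> real) \<Rightarrow> real" where
  "monotonize D T f 0 r x = f x"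
| "monotonize D T f (Suc k) r x =
     search T (Suc (k * Suc T)) r (\<lambda>z. monotonize D T f k r (x(k := quantile (D k) z))) 0 1 0 1
       (rand_cdf (D k) (x k) (r (k * Suc T)))"

primrec monotonize_tree ::
  "(nat \<Rightarrow> real measure) \<Rightarrow> nat \<Rightarrow> nat \<Rightarrow> (nat \<Rightarrow> real) \<Rightarrow> (nat \<Rightarrow> real) \<Rightarrow> (nat \<Rightarrow> real) query_tree" where
  "monotonize_tree D T 0 r x = Query x Output"
| "monotonize_tree D T (Suc k) r x =
     search_tree T (Suc (k * Suc T)) r (\<lambda>z. monotonize_tree D T k r (x(k := quantile (D k) z))) 0 1 0 1
       (rand_cdf (D k) (x k) (r (k * Suc T)))"

lemma answer_monotonize_tree: "answer (monotonize_tree D T k r x) f = monotonize D T f k r x"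
  by (induction k arbitrary: x) (auto simp: answer_search_tree)

lemma length_queries_monotonize_tree: "length (queries (monotonize_tree D T k r x) f) \<le> T ^ k"
  by (induction k arbitrary: x) (auto intro!: length_queries_search_tree)

lemma points_upd: "x \<in> points d \<Longrightarrow> k < d \<Longrightarrow> x(k := z) \<in> points d"
  by (auto simp: points_def PiE_iff extensional_def)

lemma queries_monotonize_tree_subset:
  "x \<in> points d \<Longrightarrow> k \<le> d \<Longrightarrow> set (queries (monotonize_tree D T k r x) f) \<subseteq> points d"
proof (induction k arbitrary: x)
  case (Suc k)
  then show ?case
    unfolding monotonize_tree.simps by (intro queries_search_tree_subset Suc.IH points_upd) auto
qed simp

lemma monotonize_bounds:
  assumes "f \<in> oracles d" "x \<in> points d"
  shows "0 \<le> monotonize D T f k r x \<and> monotonize D T f k r x \<le> 1"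
proof (cases k)
  case 0
  then show ?thesis using assms by (auto simp: oracles_def)
next
  case (Suc j)
  then show ?thesis by (simp add: search_bounds)
qed

text \<open>The first \<open>k\<close> stages read only the seed blocks below index
  \<open>k * Suc T\<close>. Hence the function searched in stage \<open>k\<close> does not depend on
  the seeds of that stage.\<close>

lemma monotonize_fun_upd:
  "k * Suc T \<le> j \<Longrightarrow> monotonize D T f k (r(j := u)) x = monotonize D T f k r x"
proof (induction k arbitrary: x)
  case (Suc k)
  then have j: "k * Suc T \<le> j" "k * Suc T \<noteq> j" "Suc (k * Suc T) + T \<le> j" by auto
  show ?case
    unfolding monotonize.simps search_fun_upd[OF disjI2[OF j(3)]] fun_upd_other[OF j(2)] Suc.IH[OF j(1)] ..
qed simp

section \<open>Guarantees for a fixed product distribution and oracle\<close>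

locale product_oracle =
  fixes d T :: nat and D :: "nat \<Rightarrow> real measure" and f :: "(nat \<Rightarrow> real) \<Rightarrow> real"
  assumes D: "\<And>i. real_distribution (D i)"
    and f: "f \<in> oracles d"
begin

abbreviation "N \<equiv> d * Suc T"
abbreviation "R \<equiv> PiM {..<N} (\<lambda>_. unit_uniform)"
abbreviation "P \<equiv> PiM {..<d} D"
abbreviation "G \<equiv> monotonize D T f"

sublocale D: real_distribution "D i" for i by (rule D)
sublocale U: prob_space unit_uniform by (rule prob_space_unit_uniform)
sublocale PD: product_prob_space D "{..<d}" ..
sublocale PU: product_prob_space "\<lambda>_::nat. unit_uniform" "{..<N}" ..
sublocale RP: pair_prob_space R P ..

lemma space_P: "space P = points d"
  by (simp add: space_PiM points_def D.space_eq_univ)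

lemma seed_bounds: "r \<in> space R \<Longrightarrow> j < N \<Longrightarrow> 0 < r j \<and> r j < 1"
  by (auto simp: space_PiM space_unit_uniform PiE_iff)

lemma block_less: "k < d \<Longrightarrow> Suc (k * Suc T) + T \<le> N"
proof -
  assume "k < d"
  then have "Suc k * Suc T \<le> d * Suc T" by (intro mult_right_mono) auto
  then show ?thesis by simp
qed

text \<open>After \<open>k\<close> stages monotonicity is available only in the coordinates below
  \<open>k\<close>, so the points must agree from \<open>k\<close> on. In the next stage both
  searches probe coordinate \<open>k\<close> at the same quantiles: the induction hypothesis
  compares the probed values, and \<open>search_mono\<close> accounts for the larger
  \<open>rand_cdf\<close>.\<close>

lemma monotonize_mono:
  assumes "r \<in> space R" "k \<le> d" "x \<le> x'" "\<And>i. k \<le> i \<Longrightarrow> x i = x' i"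
  shows "G k r x \<le> G k r x'"
  using assms(2-)
proof (induction k arbitrary: x x')
  case 0
  then have "x = x'" by auto
  then show ?case by simp
next
  case (Suc k)
  have "0 < r (k * Suc T)" "r (k * Suc T) < 1"
    using seed_bounds[OF assms(1), of "k * Suc T"] block_less[of k] Suc.prems(1) by auto
  then have "rand_cdf (D k) (x k) (r (k * Suc T)) \<le> rand_cdf (D k) (x' k) (r (k * Suc T))"
    using Suc.prems(2) by (intro D.rand_cdf_mono) (auto simp: le_fun_def)
  moreover have "G k r (x(k := z)) \<le> G k r (x'(k := z))" for z
    using Suc.prems by (intro Suc.IH) (auto simp: le_fun_def Suc_le_eq)
  ultimately show ?case
    by (auto intro!: search_mono)
qed

lemma bdd_above_oracle: "bdd_above (f ` {y \<in> points d. y \<le> x})"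
  using f by (intro bdd_aboveI[of _ 1]) (auto simp: oracles_def)

text \<open>By \<open>search_le\<close>, only values at pivots \<open>z\<close> up to the
  transformed coordinate have to be bounded. Such pivots replace \<open>x k\<close> by a value that
  is not larger, so the supremum bounding the recursive call runs over a subset.\<close>

lemma monotonize_feasible:
  assumes "r \<in> space R" "k \<le> d" "x \<in> points d"
  shows "G k r x \<le> (SUP y\<in>{y \<in> points d. y \<le> x}. f y)"
  using assms(2-)
proof (induction k arbitrary: x)
  case 0
  then show ?case using bdd_above_oracle by (auto intro: cSUP_upper)
next
  case (Suc k)
  define s where "s = r (k * Suc T)"
  have s: "0 < s" "s < 1"
    using seed_bounds[OF assms(1), of "k * Suc T"] block_less[of k] Suc.prems(1) by (auto simp: s_def)
  have "search T (Suc (k * Suc T)) r (\<lambda>z. G k r (x(k := quantile (D k) z))) 0 1 0 1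
      (rand_cdf (D k) (x k) s) \<le> (SUP y\<in>{y \<in> points d. y \<le> x}. f y)"
  proof (rule search_le)
    \<comment> \<open>The search starts with lower bound 0, which must not exceed the supremum
      either; the value at \<open>x\<close> itself witnesses this.\<close>
    have "0 \<le> f x" using f Suc.prems by (auto simp: oracles_def)
    also have "f x \<le> (SUP y\<in>{y \<in> points d. y \<le> x}. f y)"
      using Suc.prems bdd_above_oracle by (intro cSUP_upper) auto
    finally show "0 \<le> (SUP y\<in>{y \<in> points d. y \<le> x}. f y)" .
  next
    fix z assume z: "0 < z" "z < 1" "z \<le> rand_cdf (D k) (x k) s"
    let ?x' = "x(k := quantile (D k) z)"
    have "quantile (D k) z \<le> x k"
      using z s by (intro D.quantile_le_of_le_rand_cdf) auto
    then have le: "?x' \<le> x" by (simp add: le_fun_def)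
    have x': "?x' \<in> points d" using Suc.prems by (auto intro: points_upd)
    have "G k r ?x' \<le> (SUP y\<in>{y \<in> points d. y \<le> ?x'}. f y)"
      using Suc.prems by (intro Suc.IH[OF _ x']) simp
    also have "\<dots> \<le> (SUP y\<in>{y \<in> points d. y \<le> x}. f y)"
      using le x' by (intro cSUP_subset_mono bdd_above_oracle) (auto intro: order_trans)
    finally show "G k r ?x' \<le> (SUP y\<in>{y \<in> points d. y \<le> x}. f y)" .
  next
    fix j assume "j < Suc (k * Suc T) + T"
    then show "0 < r j \<and> r j < 1"
      using block_less[of k] Suc.prems(1) by (intro seed_bounds[OF assms(1)]) linarith
  qed auto
  then show ?case by (simp add: s_def)
qed

lemma measurable_upd:
  assumes "g \<in> M \<rightarrow>\<^sub>M P" "h \<in> borel_measurable M" "k < d"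
  shows "(\<lambda>w. (g w)(k := h w)) \<in> M \<rightarrow>\<^sub>M P"
proof (rule measurable_fun_upd[OF _ assms(1)])
  show "h \<in> M \<rightarrow>\<^sub>M D k"
    using assms(2) by (simp cong: measurable_cong_sets)
qed (use assms(3) in auto)

lemma measurable_P_component:
  assumes "g \<in> M \<rightarrow>\<^sub>M P" "k < d"
  shows "(\<lambda>w. g w k) \<in> borel_measurable M"
proof -
  have "(\<lambda>w. g w k) \<in> M \<rightarrow>\<^sub>M D k"
    by (rule measurable_compose[OF assms(1) measurable_component_singleton]) (use assms(2) in auto)
  then show ?thesis by (simp cong: measurable_cong_sets)
qed

text \<open>Joint measurability in seed and point is what the recursion passes on: the previous
  stage is evaluated at an updated point with the same seed.\<close>

lemma measurable_monotonize:
  assumes "f \<in> borel_measurable P" "k \<le> d"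
  shows "(\<lambda>(r, x). G k r x) \<in> borel_measurable (R \<Otimes>\<^sub>M P)"
  using assms(2)
proof (induction k)
  case 0
  then show ?case using assms(1) by (simp add: split_beta')
next
  case (Suc k)
  have [measurable]: "quantile (D k) \<in> borel_measurable borel" by simp
  have "(\<lambda>w. (fst (fst w), (snd (fst w))(k := quantile (D k) (snd w))))
      \<in> (R \<Otimes>\<^sub>M P) \<Otimes>\<^sub>M borel \<rightarrow>\<^sub>M R \<Otimes>\<^sub>M P"
    using Suc.prems by (intro measurable_Pair measurable_upd) auto
  from measurable_compose[OF this Suc.IH] Suc.prems
  have 1: "(\<lambda>(w, z). G k (fst w) ((snd w)(k := quantile (D k) z)))
      \<in> borel_measurable ((R \<Otimes>\<^sub>M P) \<Otimes>\<^sub>M borel)"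
    by (simp add: split_beta')
  have 2: "(\<lambda>w. fst w j) \<in> borel_measurable (R \<Otimes>\<^sub>M P)" if "j < N" for j
    using that by (intro measurable_unit_uniform_component[of _ _ "{..<N}"]) auto
  have 3: "(\<lambda>w. snd w k) \<in> borel_measurable (R \<Otimes>\<^sub>M P)"
    using Suc.prems by (intro measurable_P_component) auto
  have "(\<lambda>w. search T (Suc (k * Suc T)) (fst w)
        (\<lambda>z. G k (fst w) ((snd w)(k := quantile (D k) z))) 0 1 0 1
        (rand_cdf (D k) (snd w k) (fst w (k * Suc T)))) \<in> borel_measurable (R \<Otimes>\<^sub>M P)"
  proof (intro measurable_search[OF 1] D.measurable_rand_cdf 2 3)
    show "k * Suc T < N" using block_less[of k] Suc.prems by linarith
    show "j < N" if "j < Suc (k * Suc T) + T" for j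
      using block_less[of k] Suc.prems that by linarith
  qed simp_all
  then show ?case by (simp only: split_beta' monotonize.simps)
qed

text \<open>With the other coordinates fixed, stage \<open>k\<close> is a one-dimensional search.
  The quantile function makes the coordinate uniform, the search loses at most
  \<open>(5 / 6) ^ T\<close>, and \<open>rand_cdf\<close> with its own seed returns to inputs drawn
  from \<open>D k\<close>.\<close>

lemma nn_integral_monotonize_step:
  assumes f_measurable: "f \<in> borel_measurable P" and k: "k < d"
  shows "(\<integral>\<^sup>+x. \<integral>\<^sup>+r. ennreal (G k r x) \<partial>R \<partial>P)
    \<le> (\<integral>\<^sup>+x. \<integral>\<^sup>+r. ennreal (G (Suc k) r x) \<partial>R \<partial>P) + ennreal ((5 / 6) ^ T)"
proof -
  define n where "n = k * Suc T"
  have n: "n < N" "Suc n + T \<le> N"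
    using block_less[OF k] unfolding n_def by linarith+
  have kd: "k \<le> d" "Suc k \<le> d" "k \<in> {..<d}" using k by auto
  define H where "H j x = (\<integral>\<^sup>+r. ennreal (G j r x) \<partial>R)" for j x
  have G_measurable: "(\<lambda>w. ennreal (G j (fst w) (snd w))) \<in> borel_measurable (R \<Otimes>\<^sub>M P)"
    if "j \<le> d" for j
    using measurable_compose[OF measurable_monotonize[OF f_measurable that] measurable_ennreal]
    unfolding split_beta' .
  have H_measurable: "H j \<in> borel_measurable P" if "j \<le> d" for j
  proof -
    have "(\<lambda>w. (snd w, fst w)) \<in> P \<Otimes>\<^sub>M R \<rightarrow>\<^sub>M R \<Otimes>\<^sub>M P"
      by (intro measurable_Pair measurable_fst measurable_snd)
    from measurable_compose[OF this G_measurable[OF that]]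
    have "(\<lambda>(x, r). ennreal (G j r x)) \<in> borel_measurable (P \<Otimes>\<^sub>M R)"
      unfolding split_beta' fst_conv snd_conv .
    then show ?thesis
      unfolding H_def by (rule PU.P.borel_measurable_nn_integral)
  qed
  have resample: "(\<integral>\<^sup>+x. H j x \<partial>P) = (\<integral>\<^sup>+x. \<integral>\<^sup>+y. H j (x(k := y)) \<partial>D k \<partial>P)" if "j \<le> d" for j
    by (rule PD.nn_integral_PiM_resample[OF finite_lessThan kd(3) D.prob_space_axioms H_measurable[OF that], symmetric])
  have step: "(\<integral>\<^sup>+y. H k (x(k := y)) \<partial>D k)
      \<le> (\<integral>\<^sup>+y. H (Suc k) (x(k := y)) \<partial>D k) + ennreal ((5 / 6) ^ T)"
    if x: "x \<in> space P" for x
  proof -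
    interpret RD: pair_prob_space R "D k" ..
    define g where "g r z = G k r (x(k := quantile (D k) z))" for r z
    have g_bounds: "0 \<le> g r z" "g r z \<le> 1" for r z
      using monotonize_bounds[OF f points_upd[of x d k], of D T k r] x k
      unfolding g_def space_P by auto
    have upd: "(\<lambda>w. (fst w, x(k := snd w))) \<in> R \<Otimes>\<^sub>M M \<rightarrow>\<^sub>M R \<Otimes>\<^sub>M P"
      if "(\<lambda>y. y) \<in> borel_measurable M" for M :: "real measure"
      using k x that
      by (intro measurable_Pair measurable_upd measurable_fst measurable_const
          measurable_compose[OF measurable_snd]) auto
    have id: "(\<lambda>y. y) \<in> borel_measurable (D k)" "(\<lambda>y. y) \<in> borel_measurable (borel :: real measure)"
      by auto
    have Gx: "(\<lambda>(r, y). ennreal (G j r (x(k := y)))) \<in> borel_measurable (R \<Otimes>\<^sub>M D k)" if "j \<le> d" for j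
      using measurable_compose[OF upd[OF id(1)] G_measurable[OF that]]
      unfolding split_beta' fst_conv snd_conv .
    have swap: "(\<integral>\<^sup>+y. H j (x(k := y)) \<partial>D k) = (\<integral>\<^sup>+r. \<integral>\<^sup>+y. ennreal (G j r (x(k := y))) \<partial>D k \<partial>R)"
      if "j \<le> d" for j
      unfolding H_def by (rule RD.Fubini'[OF Gx[OF that]])
    have Gr: "(\<lambda>y. ennreal (G k r (x(k := y)))) \<in> borel_measurable borel" if "r \<in> space R" for r
      using measurable_Pair2[OF Gx[OF kd(1)] that] by (simp cong: measurable_cong_sets)
    have g: "(\<lambda>(r, z). g r z) \<in> borel_measurable (R \<Otimes>\<^sub>M borel)"
    proof -
      have "(\<lambda>w. (fst w, quantile (D k) (snd w))) \<in> R \<Otimes>\<^sub>M borel \<rightarrow>\<^sub>M R \<Otimes>\<^sub>M borel"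
        by (intro measurable_Pair measurable_fst measurable_compose[OF measurable_snd] D.measurable_quantile)
      from measurable_compose[OF measurable_compose[OF this upd[OF id(2)]]
          measurable_monotonize[OF f_measurable kd(1)]]
      show ?thesis unfolding split_beta' fst_conv snd_conv g_def .
    qed
    define S where "S r z = search T (Suc n) r (g r) 0 1 0 1 z" for r z
    have S: "S r \<in> borel_measurable borel" if "r \<in> space R" for r
      unfolding S_def using measurable_Pair2[OF g that]
      by (intro measurable_search) (auto simp: split_beta')
    \<comment> \<open>Seed \<open>n\<close> enters only through \<open>rand_cdf\<close>: the
      previous stage reads smaller indices and the search larger ones.\<close>
    have G_Suc: "G (Suc k) (r(n := s)) (x(k := y)) = S r (rand_cdf (D k) y s)" for r s y
    proof -
      have "G k (r(n := s)) = G k r"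
        using monotonize_fun_upd[of k T n D f r s] by (intro ext) (simp add: n_def)
      then show ?thesis
        by (simp add: S_def g_def[abs_def] n_def[symmetric] search_fun_upd del: mult_Suc_right)
    qed
    have "(\<integral>\<^sup>+y. H k (x(k := y)) \<partial>D k) = (\<integral>\<^sup>+r. \<integral>\<^sup>+y. ennreal (G k r (x(k := y))) \<partial>D k \<partial>R)"
      by (rule swap[OF kd(1)])
    also have "\<dots> = (\<integral>\<^sup>+r. \<integral>\<^sup>+z. ennreal (g r z) \<partial>unit_uniform \<partial>R)"
      unfolding g_def by (intro nn_integral_cong D.nn_integral_quantile[symmetric] Gr)
    also have "\<dots> = (\<integral>\<^sup>+r. (\<integral>\<^sup>+z\<in>{0<..<1}. ennreal (clip 0 1 (g r z)) \<partial>lborel) \<partial>R)"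
      using g_bounds by (simp add: nn_integral_unit_uniform clip_def)
    \<comment> \<open>The search starts from the unit square; the trivial factors keep its area in
      the form of the general bound.\<close>
    also have "\<dots> \<le> (\<integral>\<^sup>+r. (\<integral>\<^sup>+z\<in>{0<..<1}. ennreal (S r z) \<partial>lborel) \<partial>R)
        + ennreal ((5 / 6) ^ T) * (\<integral>\<^sup>+r. ennreal ((1 - 0) * (1 - 0)) \<partial>R)"
      unfolding S_def
    proof (rule nn_integral_search[OF refl g n(2)])
      show "\<forall>r j u. Suc n \<le> j \<longrightarrow> j < Suc n + T \<longrightarrow>
        0 = (0 :: real) \<and> 1 = (1 :: real) \<and> 0 = (0 :: real) \<and> 1 = (1 :: real) \<and> g (r(j := u)) = g r"
        by (auto simp only: g_def n_def monotonize_fun_upd Suc_leD intro!: ext)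
    qed auto
    also have "(\<integral>\<^sup>+r. ennreal ((1 - 0) * (1 - 0)) \<partial>R) = 1"
      by (simp add: PU.P.emeasure_space_1 del: mult_Suc_right)
    \<comment> \<open>The uniform point is replaced by the transform of \<open>y\<close> drawn from
      \<open>D k\<close>, with a position \<open>s\<close> separate from the seeds
      \<open>r\<close>.\<close>
    also have "(\<integral>\<^sup>+r. (\<integral>\<^sup>+z\<in>{0<..<1}. ennreal (S r z) \<partial>lborel) \<partial>R) =
      (\<integral>\<^sup>+r. \<integral>\<^sup>+y. \<integral>\<^sup>+s. ennreal (S r (rand_cdf (D k) y s)) \<partial>unit_uniform \<partial>D k \<partial>R)"
      unfolding nn_integral_unit_uniform[symmetric]
      by (intro nn_integral_cong D.nn_integral_rand_cdf[symmetric] measurable_compose[OF S measurable_ennreal])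
    also have "\<dots> = (\<integral>\<^sup>+y. \<integral>\<^sup>+r. \<integral>\<^sup>+s. ennreal (G (Suc k) (r(n := s)) (x(k := y))) \<partial>unit_uniform \<partial>R \<partial>D k)"
    proof -
      have "(\<lambda>w. ((fst (fst w))(n := snd w), snd (fst w))) \<in>
        (R \<Otimes>\<^sub>M D k) \<Otimes>\<^sub>M unit_uniform \<rightarrow>\<^sub>M R \<Otimes>\<^sub>M D k"
        using n(1)
        by (intro measurable_Pair measurable_fun_upd[of "{..<N}" "{..<N}"]) auto
      from measurable_compose[OF this Gx[OF kd(2)]]
      have "(\<lambda>(w, s). ennreal (G (Suc k) ((fst w)(n := s)) (x(k := snd w))))
          \<in> borel_measurable ((R \<Otimes>\<^sub>M D k) \<Otimes>\<^sub>M unit_uniform)"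
        unfolding split_beta' fst_conv snd_conv .
      from U.borel_measurable_nn_integral[OF this]
      have "(\<lambda>(r, y). \<integral>\<^sup>+s. ennreal (G (Suc k) (r(n := s)) (x(k := y))) \<partial>unit_uniform)
          \<in> borel_measurable (R \<Otimes>\<^sub>M D k)"
        unfolding split_beta' .
      from RD.Fubini'[OF this] show ?thesis
        unfolding G_Suc ..
    qed
    \<comment> \<open>The separate variable \<open>s\<close> is absorbed into \<open>R\<close> as
      seed \<open>n\<close>, by resampling that seed.\<close>
    also have "\<dots> = (\<integral>\<^sup>+y. H (Suc k) (x(k := y)) \<partial>D k)"
      unfolding H_def
    proof (rule nn_integral_cong)
      fix y assume y: "y \<in> space (D k)"
      have "(\<lambda>r. ennreal (G (Suc k) r (x(k := y)))) \<in> borel_measurable R"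
        using measurable_Pair1[OF Gx[OF kd(2)] y] by simp
      then show "(\<integral>\<^sup>+r. \<integral>\<^sup>+s. ennreal (G (Suc k) (r(n := s)) (x(k := y))) \<partial>unit_uniform \<partial>R)
        = (\<integral>\<^sup>+r. ennreal (G (Suc k) r (x(k := y))) \<partial>R)"
        using n(1) by (intro PU.nn_integral_PiM_resample U.prob_space_axioms) auto
    qed
    finally show ?thesis by (simp only: mult_1_right)
  qed
  have "(\<integral>\<^sup>+x. H k x \<partial>P) \<le> (\<integral>\<^sup>+x. (\<integral>\<^sup>+y. H (Suc k) (x(k := y)) \<partial>D k) + ennreal ((5 / 6) ^ T) \<partial>P)"
    unfolding resample[OF kd(1)] by (intro nn_integral_mono step)
  also have "\<dots> = (\<integral>\<^sup>+x. H (Suc k) x \<partial>P) + ennreal ((5 / 6) ^ T)"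
  proof -
    have "(\<lambda>(x, y). x(k := y)) \<in> P \<Otimes>\<^sub>M D k \<rightarrow>\<^sub>M P"
      unfolding split_beta' using k by (intro measurable_fun_upd[of "{..<d}" "{..<d}"]) auto
    from measurable_compose[OF this H_measurable[OF kd(2)]]
    have "(\<lambda>(x, y). H (Suc k) (x(k := y))) \<in> borel_measurable (P \<Otimes>\<^sub>M D k)"
      unfolding split_beta' .
    from D.borel_measurable_nn_integral[OF this] show ?thesis
      unfolding resample[OF kd(2)]
      by (subst nn_integral_add) (simp_all add: PD.P.emeasure_space_1)
  qed
  finally show ?thesis
    unfolding H_def .
qed

lemma nn_integral_monotonize:
  assumes "f \<in> borel_measurable P"
  shows "(\<integral>\<^sup>+x. ennreal (f x) \<partial>P)
    \<le> (\<integral>\<^sup>+x. \<integral>\<^sup>+r. ennreal (G d r x) \<partial>R \<partial>P) + ennreal (real d * (5 / 6) ^ T)"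
proof -
  have "k \<le> d \<Longrightarrow> (\<integral>\<^sup>+x. ennreal (f x) \<partial>P)
    \<le> (\<integral>\<^sup>+x. \<integral>\<^sup>+r. ennreal (G k r x) \<partial>R \<partial>P) + ennreal (real k * (5 / 6) ^ T)" for k
  proof (induction k)
    case 0
    then show ?case by (simp add: PU.P.emeasure_space_1 del: mult_Suc_right)
  next
    case (Suc k)
    have "(\<integral>\<^sup>+x. ennreal (f x) \<partial>P)
      \<le> (\<integral>\<^sup>+x. \<integral>\<^sup>+r. ennreal (G k r x) \<partial>R \<partial>P) + ennreal (real k * (5 / 6) ^ T)"
      using Suc by simp
    also have "\<dots> \<le> ((\<integral>\<^sup>+x. \<integral>\<^sup>+r. ennreal (G (Suc k) r x) \<partial>R \<partial>P) + ennreal ((5 / 6) ^ T))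
        + ennreal (real k * (5 / 6) ^ T)"
      using Suc.prems by (intro add_right_mono nn_integral_monotonize_step assms) simp
    also have "\<dots> = (\<integral>\<^sup>+x. \<integral>\<^sup>+r. ennreal (G (Suc k) r x) \<partial>R \<partial>P)
        + ennreal ((5 / 6) ^ T + real k * (5 / 6) ^ T)"
      by (simp only: ennreal_plus add.assoc mult_nonneg_nonneg of_nat_0_le_iff zero_le_power
          zero_le_divide_iff zero_le_numeral simp_thms)
    also have "(5 / 6) ^ T + real k * (5 / 6) ^ T = real (Suc k) * (5 / 6) ^ T"
      by (simp add: algebra_simps)
    finally show ?case .
  qed
  then show ?thesis by simp
qed

text \<open>Transfers the bound to Bochner integrals: on the points the integrands take values in
  the unit interval, so they are integrable.\<close>

lemma integral_monotonize:
  assumes f_measurable: "f \<in> borel_measurable P"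
  shows "(\<integral>x. f x \<partial>P) - real d * (5 / 6) ^ T \<le> (\<integral>(r, x). G d r x \<partial>(R \<Otimes>\<^sub>M P))"
proof -
  have f_bounds: "0 \<le> f x" "f x \<le> 1" if "x \<in> space P" for x
    using f that by (auto simp: oracles_def space_P)
  have G_bounds: "0 \<le> G d r x" "G d r x \<le> 1" if "x \<in> space P" for r x
    using monotonize_bounds[OF f, of x] that by (auto simp: space_P)
  note G_measurable = measurable_monotonize[OF f_measurable order_refl]
  have f_int: "(\<integral>\<^sup>+x. ennreal (f x) \<partial>P) = ennreal (\<integral>x. f x \<partial>P)"
    using f_bounds f_measurable
    by (intro nn_integral_eq_integral PD.P.integrable_const_bound[where B=1]) auto
  have "(\<integral>\<^sup>+x. \<integral>\<^sup>+r. ennreal (G d r x) \<partial>R \<partial>P) = (\<integral>\<^sup>+(r, x). ennreal (G d r x) \<partial>(R \<Otimes>\<^sub>M P))"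
    using measurable_compose[OF G_measurable measurable_ennreal]
    by (subst RP.nn_integral_snd[symmetric]) (auto simp: split_beta')
  also have "\<dots> = (\<integral>\<^sup>+w. ennreal (case w of (r, x) \<Rightarrow> G d r x) \<partial>(R \<Otimes>\<^sub>M P))"
    by (simp only: split_beta')
  also have "\<dots> = ennreal (\<integral>(r, x). G d r x \<partial>(R \<Otimes>\<^sub>M P))"
    using G_bounds G_measurable
    by (intro nn_integral_eq_integral RP.P.integrable_const_bound[where B=1])
       (auto simp: space_pair_measure)
  finally have "ennreal (\<integral>x. f x \<partial>P) \<le>
      ennreal (\<integral>(r, x). G d r x \<partial>(R \<Otimes>\<^sub>M P)) + ennreal (real d * (5 / 6) ^ T)"
    using nn_integral_monotonize[OF f_measurable] f_int by simp
  moreover have nonneg: "0 \<le> (\<integral>(r, x). G d r x \<partial>(R \<Otimes>\<^sub>M P))"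
    using G_bounds by (intro integral_nonneg_AE AE_I2) (auto simp: space_pair_measure)
  moreover have "ennreal ((\<integral>(r, x). G d r x \<partial>(R \<Otimes>\<^sub>M P)) + real d * (5 / 6) ^ T) =
      ennreal (\<integral>(r, x). G d r x \<partial>(R \<Otimes>\<^sub>M P)) + ennreal (real d * (5 / 6) ^ T)"
    using nonneg by (intro ennreal_plus) auto
  ultimately have "ennreal (\<integral>x. f x \<partial>P) \<le>
      ennreal ((\<integral>(r, x). G d r x \<partial>(R \<Otimes>\<^sub>M P)) + real d * (5 / 6) ^ T)"
    by (simp only:)
  then have "(\<integral>x. f x \<partial>P) \<le> (\<integral>(r, x). G d r x \<partial>(R \<Otimes>\<^sub>M P)) + real d * (5 / 6) ^ T"
    using nonneg by (subst (asm) ennreal_le_iff) auto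
  then show ?thesis by simp
qed

end

text \<open>\<open>T\<close> is the logarithm of \<open>d / \<epsilon>\<close> to base
  \<open>6 / 5\<close>, rounded up, so that the \<open>d\<close> stages together lose at most
  \<open>\<epsilon>\<close>. If \<open>d / \<epsilon> \<ge> 2\<close>, the 1 from rounding is at
  most \<open>ln (d / \<epsilon>) / ln 2\<close>, which gives a pure multiple of the
  logarithm.\<close>

lemma exists_search_depth:
  fixes d :: nat and \<epsilon> :: real
  assumes "d \<ge> 1" "0 < \<epsilon>" "\<epsilon> < 1"
  obtains T :: nat where "real d * (5 / 6) ^ T \<le> \<epsilon>"
    and "real d / \<epsilon> \<ge> 2 \<Longrightarrow> real T \<le> (1 / ln (6 / 5) + 1 / ln 2) * ln (real d / \<epsilon>)"
proof
  define x where "x = real d / \<epsilon>"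
  have "1 \<le> x" using assms by (simp add: x_def field_simps)
  define T where "T = nat \<lceil>ln x / ln (6 / 5)\<rceil>"
  have ln65: "0 < ln (6 / 5 :: real)" by simp
  have T: "ln x / ln (6 / 5) \<le> real T" "real T \<le> ln x / ln (6 / 5) + 1"
    using \<open>1 \<le> x\<close> ln65 by (auto simp: T_def intro: real_nat_ceiling_ge)
  have "ln x \<le> real T * ln (6 / 5)"
    using T(1) ln65 by (simp add: field_simps)
  also have "\<dots> = ln ((6 / 5) ^ T)"
    by (simp add: ln_realpow)
  finally have "x \<le> (6 / 5) ^ T"
    using \<open>1 \<le> x\<close> by (subst (asm) ln_le_cancel_iff) auto
  then have "x * (5 / 6) ^ T \<le> (6 / 5) ^ T * (5 / 6) ^ T"
    by (intro mult_right_mono) auto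
  also have "\<dots> = 1"
    by (simp flip: power_mult_distrib)
  finally show "real d * (5 / 6) ^ T \<le> \<epsilon>"
    using assms by (simp add: x_def field_simps)
  assume "real d / \<epsilon> \<ge> 2"
  then have "ln 2 \<le> ln x"
    by (simp add: x_def)
  then have "1 \<le> ln x / ln 2" by simp
  then have "real T \<le> ln x / ln (6 / 5) + ln x / ln 2"
    using T(2) by linarith
  then show "real T \<le> (1 / ln (6 / 5) + 1 / ln 2) * ln (real d / \<epsilon>)"
    by (simp add: x_def distrib_right)
qed

section \<open>Assembly of the algorithm and its four guarantees\<close>

theorem theorem1:
  "\<exists>C::real. C > 0 \<and>
    (\<forall>(d::nat) (D :: nat \<Rightarrow> real measure) (\<epsilon>::real).
      d \<ge> 1 \<longrightarrow> (\<forall>i<d. real_distribution (D i)) \<longrightarrow> 0 < \<epsilon> \<longrightarrow> \<epsilon> < 1 \<longrightarrow>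
      (\<exists>M. meta_algorithm d M \<and>
        (\<forall>f\<in>oracles d. \<forall>r\<in>space (seeds M). mono_on (points d) (result M f r)) \<and>
        (\<forall>f\<in>oracles d. \<forall>r\<in>space (seeds M). \<forall>x\<in>points d.
           result M f r x \<le> (SUP y\<in>{y \<in> points d. y \<le> x}. f y)) \<and>
        (\<exists>q::nat. query_complexity d M = enat q \<and>
           (real d / \<epsilon> \<ge> 2 \<longrightarrow> real q \<le> (C * ln (real d / \<epsilon>)) ^ d)) \<and>
        (\<forall>f\<in>oracles d. f \<in> borel_measurable (PiM {..<d} D) \<longrightarrow>
           (\<lambda>(r, x). result M f r x) \<in> borel_measurable (seeds M \<Otimes>\<^sub>M PiM {..<d} D) \<and>
           (\<integral>(r, x). result M f r x \<partial>(seeds M \<Otimes>\<^sub>M PiM {..<d} D))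
             \<ge> (\<integral>x. f x \<partial>PiM {..<d} D) - \<epsilon>)))"
proof -
  define C where "C = 1 / ln (6 / 5) + 1 / ln (2 :: real)"
  have C: "0 < C"
    by (auto simp: C_def intro!: add_pos_pos)
  show ?thesis
  proof (intro exI[of _ C] conjI allI impI C)
    fix d :: nat and D :: "nat \<Rightarrow> real measure" and \<epsilon> :: real
    assume d: "d \<ge> 1" and D: "\<forall>i<d. real_distribution (D i)" and \<epsilon>: "0 < \<epsilon>" "\<epsilon> < 1"
    obtain T :: nat where loss: "real d * (5 / 6) ^ T \<le> \<epsilon>"
      and T: "real d / \<epsilon> \<ge> 2 \<Longrightarrow> real T \<le> C * ln (real d / \<epsilon>)"
      using exists_search_depth[OF d \<epsilon>] unfolding C_def by blast
    \<comment> \<open>Only the distributions below \<open>d\<close> are constrained. Padding with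
      \<open>D 0\<close>, available because \<open>d \<ge> 1\<close>, gives a real distribution at
      every index, as \<open>product_oracle\<close> requires, and leaves the product
      unchanged.\<close>
    define D' where "D' i = (if i < d then D i else D 0)" for i
    have D': "real_distribution (D' i)" for i
      using D d by (simp add: D'_def)
    have PiM_D: "PiM {..<d} D = PiM {..<d} D'"
      by (intro PiM_cong) (auto simp: D'_def)
    define M where "M = \<lparr>seeds = PiM {..<d * Suc T} (\<lambda>_. unit_uniform), strategy = monotonize_tree D' T d\<rparr>"
    have seeds: "seeds M = PiM {..<d * Suc T} (\<lambda>_. unit_uniform)"
      by (simp add: M_def)
    have result: "result M f = monotonize D' T f d" for f
      by (auto simp: M_def result_def answer_monotonize_tree fun_eq_iff)
    have prod_oracle: "product_oracle d D' f" if "f \<in> oracles d" for f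
      using that D' by (simp add: product_oracle_def)
    have q: "query_complexity d M \<le> enat (T ^ d)"
      unfolding query_complexity_def
      by (intro SUP_least) (auto simp: M_def length_queries_monotonize_tree)
    show "\<exists>M. meta_algorithm d M \<and>
          (\<forall>f\<in>oracles d. \<forall>r\<in>space (seeds M). mono_on (points d) (result M f r)) \<and>
          (\<forall>f\<in>oracles d. \<forall>r\<in>space (seeds M). \<forall>x\<in>points d.
             result M f r x \<le> (SUP y\<in>{y \<in> points d. y \<le> x}. f y)) \<and>
          (\<exists>q::nat. query_complexity d M = enat q \<and>
             (real d / \<epsilon> \<ge> 2 \<longrightarrow> real q \<le> (C * ln (real d / \<epsilon>)) ^ d)) \<and>
          (\<forall>f\<in>oracles d. f \<in> borel_measurable (PiM {..<d} D) \<longrightarrow>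
             (\<lambda>(r, x). result M f r x) \<in> borel_measurable (seeds M \<Otimes>\<^sub>M PiM {..<d} D) \<and>
             (\<integral>(r, x). result M f r x \<partial>(seeds M \<Otimes>\<^sub>M PiM {..<d} D))
               \<ge> (\<integral>x. f x \<partial>PiM {..<d} D) - \<epsilon>)"
    proof (rule exI[of _ M], intro conjI ballI impI)
      have "prob_space (seeds M)"
        unfolding seeds by (intro prob_space_PiM prob_space_unit_uniform)
      moreover have "set (queries (strategy M r x) f) \<subseteq> points d" if "x \<in> points d" for f r x
        using queries_monotonize_tree_subset[OF that order_refl] by (simp add: M_def)
      moreover have "result M f r x \<in> {0..1}" if "f \<in> oracles d" "x \<in> points d" for f r x
        using monotonize_bounds[OF that] by (simp add: result)
      ultimately show "meta_algorithm d M"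
        unfolding meta_algorithm_def by blast
    next
      fix f r assume f: "f \<in> oracles d" and r: "r \<in> space (seeds M)"
      interpret product_oracle d T D' f by (rule prod_oracle[OF f])
      show "mono_on (points d) (result M f r)"
      proof (rule mono_onI)
        fix x y assume xy: "x \<in> points d" "y \<in> points d" "x \<le> y"
        \<comment> \<open>By extensionality both points carry the same default value outside the
          dimension, so they agree from \<open>d\<close> on as \<open>monotonize_mono\<close>
          requires.\<close>
        have "x i = y i" if "d \<le> i" for i
          using xy(1,2) that by (simp add: points_def PiE_iff extensional_def)
        then show "result M f r x \<le> result M f r y"
          unfolding result using r[unfolded seeds] xy by (intro monotonize_mono) auto
      qed
      fix x assume x: "x \<in> points d"
      show "result M f r x \<le> (SUP y\<in>{y \<in> points d. y \<le> x}. f y)"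
        unfolding result using r[unfolded seeds] x by (intro monotonize_feasible) auto
    next
      \<comment> \<open>The complexity is a supremum in \<open>enat\<close>; the uniform bound
        \<open>T ^ d\<close> makes it finite.\<close>
      obtain q where q': "query_complexity d M = enat q" "q \<le> T ^ d"
        using q by (cases "query_complexity d M") auto
      have "real q \<le> (C * ln (real d / \<epsilon>)) ^ d" if "real d / \<epsilon> \<ge> 2"
      proof -
        have "real q \<le> real (T ^ d)" using q'(2) by (rule of_nat_mono)
        also have "\<dots> = real T ^ d" by simp
        also have "\<dots> \<le> (C * ln (real d / \<epsilon>)) ^ d"
          using T[OF that] by (intro power_mono) auto
        finally show ?thesis .
      qed
      with q'(1) show "\<exists>q::nat. query_complexity d M = enat q \<and>
          (real d / \<epsilon> \<ge> 2 \<longrightarrow> real q \<le> (C * ln (real d / \<epsilon>)) ^ d)"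
        by blast
    next
      fix f assume f: "f \<in> oracles d" and f_measurable: "f \<in> borel_measurable (PiM {..<d} D)"
      interpret product_oracle d T D' f by (rule prod_oracle[OF f])
      show "(\<lambda>(r, x). result M f r x) \<in> borel_measurable (seeds M \<Otimes>\<^sub>M PiM {..<d} D)"
        unfolding result seeds PiM_D
        using measurable_monotonize[OF f_measurable[unfolded PiM_D] order_refl] .
      show "(\<integral>(r, x). result M f r x \<partial>(seeds M \<Otimes>\<^sub>M PiM {..<d} D)) \<ge> (\<integral>x. f x \<partial>PiM {..<d} D) - \<epsilon>"
        unfolding result seeds PiM_D
        using integral_monotonize[OF f_measurable[unfolded PiM_D]] loss by linarith
    qed
  qed
qed

end
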